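(* Let $a>0$ and $\epsilon\in[0,\tfrac12]$ be fixed, and consider the binary censored block model with $p=a\log n/n$. Let $\widehat Y_{\mathrm{SDP}}$ be the solution of $$\max_Y\ \langle A,Y\rangle\quad\text{s.t.}\quad Y\succeq0,\ \ Y_{ii}=1\ (i\in[n]).$$ If $a(\sqrt{1-\epsilon}-\sqrt\epsilon)^2>1$, then $\min_{Y^*\in\mathcal Y_n}\mathbb P\{\widehat Y_{\mathrm{SDP}}=Y^*\}\ge1-n^{-\Omega(1)}$ as $n\to\infty$ (where $\widehat Y_{\mathrm{SDP}}=Y^*$ means $Y^*$ is the unique optimal solution).
   Context: Binary censored block model: $\sigma^*\in\{\pm1\}^n$ is the true labeling. The graph $G$ is Erdős–Rényi $\mathcal G(n,p)$ (independent of $\sigma^*$), and each edge $(i,j)$ independently receives a label $L_{ij}\in\{\pm1\}$ with $L_{ij}=\sigma^*_i\sigma^*_j$ with probability $1-\epsilon$ and $L_{ij}=-\sigma^*_i\sigma^*_j$ with probability $\epsilon$. $A$ is the symmetric weighted adjacency matrix: $A_{ij}=0$ if $\{i,j\}$ is not an edge and $A_{ij}=L_{ij}$ otherwise ($A_{ii}=0$). $Y^*=\sigma^*(\sigma^* )^\top$, $\mathcal Y_n=\{\sigma\sigma^\top:\sigma\in\{\pm1\}^n\}$. *)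

theory Defs
  imports "HOL-Probability.Probability"
begin

text \<open>Vertices are 0..<n. Unordered pairs are represented as (i,j) with i<j<n.\<close>

definition cbm_pairs :: "nat \<Rightarrow> (nat \<times> nat) set" where
  "cbm_pairs n = {(i,j). i < j \<and> j < n}"

definition cbm_entry_pmf :: "real \<Rightarrow> real \<Rightarrow> real \<Rightarrow> real pmf" where
  "cbm_entry_pmf p eps s =
     bind_pmf (bernoulli_pmf p)
       (\<lambda>e. if e then map_pmf (\<lambda>flip. if flip then - s else s) (bernoulli_pmf eps)
            else return_pmf 0)"

definition cbm_pmf :: "nat \<Rightarrow> real \<Rightarrow> real \<Rightarrow> (nat \<Rightarrow> real) \<Rightarrow> (nat \<times> nat \<Rightarrow> real) pmf" where
  "cbm_pmf n p eps \<sigma> = Pi_pmf (cbm_pairs n) 0 (\<lambda>(i,j). cbm_entry_pmf p eps (\<sigma> i * \<sigma> j))"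

definition cbm_adj :: "(nat \<times> nat \<Rightarrow> real) \<Rightarrow> nat \<Rightarrow> nat \<Rightarrow> real" where
  "cbm_adj W i j = (if i < j then W (i,j) else if j < i then W (j,i) else 0)"

text \<open>n x n real matrices are represented as nat => nat => real, only indices < n matter.\<close>
definition psd :: "nat \<Rightarrow> (nat \<Rightarrow> nat \<Rightarrow> real) \<Rightarrow> bool" where
  "psd n Y \<longleftrightarrow> (\<forall>i<n. \<forall>j<n. Y i j = Y j i) \<and>
     (\<forall>x :: nat \<Rightarrow> real. (\<Sum>i<n. \<Sum>j<n. x i * Y i j * x j) \<ge> 0)"

definition frob_inner :: "nat \<Rightarrow> (nat \<Rightarrow> nat \<Rightarrow> real) \<Rightarrow> (nat \<Rightarrow> nat \<Rightarrow> real) \<Rightarrow> real" where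
  "frob_inner n A Y = (\<Sum>i<n. \<Sum>j<n. A i j * Y i j)"

definition sdp_feasible :: "nat \<Rightarrow> (nat \<Rightarrow> nat \<Rightarrow> real) \<Rightarrow> bool" where
  "sdp_feasible n Y \<longleftrightarrow> psd n Y \<and> (\<forall>i<n. Y i i = 1)"

definition sdp_unique_opt :: "nat \<Rightarrow> (nat \<Rightarrow> nat \<Rightarrow> real) \<Rightarrow> (nat \<Rightarrow> nat \<Rightarrow> real) \<Rightarrow> bool" where
  "sdp_unique_opt n A Y0 \<longleftrightarrow> sdp_feasible n Y0 \<and>
     (\<forall>Y. sdp_feasible n Y \<and> (\<exists>i<n. \<exists>j<n. Y i j \<noteq> Y0 i j) \<longrightarrow>
          frob_inner n A Y < frob_inner n A Y0)"

end

theory Submission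
  imports Defs
begin

text \<open>
  Let \<open>B\<close> be \<open>A\<close> conjugated by the true labels, \<open>d\<close> its row sums and \<open>L = ln n\<close>. By a Gram
  decomposition of the feasible matrices, \<open>\<sigma>\<sigma>\<^sup>T\<close> is the unique optimum as soon as
  \<open>u\<^sup>TBu < \<Sum>d\<^sub>iu\<^sub>i\<^sup>2\<close> for all \<open>u \<noteq> 0\<close> with zero sum. The hypothesis on \<open>a\<close> is exactly what makes
  \<open>d\<^sub>i > D L\<close> for some \<open>D > 0\<close> and all \<open>i\<close> by Chernoff's bound, so an estimate \<open>u\<^sup>T(B - EB)u \<le> D L \<bar>u\<bar>\<^sup>2\<close> suffices;
  this is weaker than the true order \<open>sqrt L\<close> of the spectral norm and has an elementary proof.
  The form has no diagonal, hence is affine in each coordinate, and \<open>u\<close> (scaled to \<open>\<bar>u\<bar>\<^sup>2 = n\<close>) may be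
  rounded to an integer vector \<open>z\<close> with \<open>\<bar>z\<bar>\<^sup>2 \<le> 4n\<close>; there are only \<open>exp (O(n))\<close> of those. Pairs with
  \<open>\<bar>z\<^sub>iz\<^sub>j\<bar>\<close> below a constant are handled by Chernoff's bound and a union bound over \<open>z\<close>. For the other pairs,
  those with \<open>z\<^sub>i\<close>, \<open>z\<^sub>j\<close> of very different size are controlled by the maximal degree, and those with
  comparable entries live on a small vertex set, inside which every subset spans few edges.
\<close>

subsection \<open>Dual certificate\<close>

lemma quad_form_Suc:
  fixes Y :: "nat \<Rightarrow> nat \<Rightarrow> real"
  assumes "\<And>i. i < n \<Longrightarrow> Y n i = Y i n"
  shows "(\<Sum>i<Suc n. \<Sum>j<Suc n. x i * Y i j * x j) =
    (\<Sum>i<n. \<Sum>j<n. x i * Y i j * x j) + 2 * x n * (\<Sum>i<n. x i * Y i n) + (x n)\<^sup>2 * Y n n"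
proof -
  have "(\<Sum>j<n. x n * Y n j * x j) = x n * (\<Sum>i<n. x i * Y i n)"
    unfolding sum_distrib_left by (rule sum.cong) (auto simp: assms)
  moreover have "(\<Sum>i<n. x i * Y i n * x n) = x n * (\<Sum>i<n. x i * Y i n)"
    unfolding sum_distrib_left by (rule sum.cong) auto
  ultimately show ?thesis
    by (simp add: sum.distrib power2_eq_square algebra_simps)
qed

text \<open>Along \<open>e_j + t e_n\<close> the form equals \<open>Y j j + 2 t Y j n\<close>,
  because \<open>Y n n = 0\<close>. This is affine in \<open>t\<close> and would be unbounded below
  if the slope were nonzero.\<close>

lemma psd_zero_diag:
  assumes "psd (Suc n) Y" "Y n n = 0" "j < n"
  shows "Y j n = 0"
proof (rule ccontr)
  assume nz: "Y j n \<noteq> 0"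
  have sym: "\<And>i. i < n \<Longrightarrow> Y n i = Y i n"
    using assms(1) by (auto simp: psd_def)
  \<comment> \<open>The weight at \<open>n\<close> is the value of \<open>t\<close> at which the
    form equals -1.\<close>
  define x where "x i = (if i = j then 1 else if i = n then - (Y j j + 1) / (2 * Y j n) else 0)" for i
  have "0 \<le> (\<Sum>i<Suc n. \<Sum>j<Suc n. x i * Y i j * x j)"
    using assms(1) unfolding psd_def by blast
  also have "\<dots> = (\<Sum>i<n. \<Sum>j<n. x i * Y i j * x j) + 2 * x n * (\<Sum>i<n. x i * Y i n)"
    using quad_form_Suc[of n Y x] sym assms(2) by simp
  also have "(\<Sum>i<n. x i * Y i n) = (\<Sum>i<n. if i = j then Y j n else 0)"
    by (rule sum.cong) (auto simp: x_def)
  also have "\<dots> = Y j n" using assms(3) by simp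
  also have "(\<Sum>i<n. \<Sum>k<n. x i * Y i k * x k) = (\<Sum>i<n. \<Sum>k<n. if i = j \<and> k = j then Y j j else 0)"
    by (intro sum.cong refl) (auto simp: x_def)
  also have "\<dots> = (\<Sum>i<n. if i = j then (\<Sum>k<n. if k = j then Y j j else 0) else 0)"
    by (intro sum.cong refl) auto
  also have "\<dots> = Y j j" using assms(3) by simp
  also have "Y j j + 2 * x n * Y j n = -1"
    using nz assms(3) by (simp add: x_def field_simps)
  finally show False by simp
qed

text \<open>Cholesky elimination: the Schur complement of the last diagonal entry is again positive
  semidefinite and factors by induction; the last column divided by \<open>sqrt y\<close> supplies
  the remaining row of the factor.\<close>

lemma psd_gram:
  assumes "psd n Y"
  shows "\<exists>V. \<forall>i<n. \<forall>j<n. Y i j = (\<Sum>k<n. V k i * V k j)"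
  using assms
proof (induction n arbitrary: Y)
  case 0
  then show ?case by simp
next
  case (Suc n)
  have sym: "\<And>i. i < n \<Longrightarrow> Y n i = Y i n" and sym': "\<And>i j. i < n \<Longrightarrow> j < n \<Longrightarrow> Y i j = Y j i"
    using Suc.prems by (auto simp: psd_def)
  define y where "y = Y n n"
  have zero: "Y j n = 0" if "y = 0" "j < n" for j
    using psd_zero_diag[OF Suc.prems] that by (simp add: y_def)
  have y0: "y \<ge> 0"
  proof -
    define x :: "nat \<Rightarrow> real" where "x i = (if i = n then 1 else 0)" for i
    have "0 \<le> (\<Sum>i<Suc n. \<Sum>j<Suc n. x i * Y i j * x j)"
      using Suc.prems unfolding psd_def by blast
    also have "\<dots> = y"
      using quad_form_Suc[of n Y x] sym by (simp add: x_def y_def)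
    finally show ?thesis .
  qed
  \<comment> \<open>If \<open>y = 0\<close>, the quotient is 0 by convention and the last column
    vanishes by \<open>zero\<close>, so one formula serves both cases.\<close>
  define Z where "Z i j = Y i j - Y i n * Y j n / y" for i j
  have "psd n Z"
    unfolding psd_def
  proof (intro conjI allI impI)
    show "Z i j = Z j i" if "i < n" "j < n" for i j
      using sym'[OF that] by (simp add: Z_def)
    fix x :: "nat \<Rightarrow> real"
    define c where "c = (\<Sum>i<n. x i * Y i n)"
    \<comment> \<open>For \<open>y > 0\<close> the last coordinate \<open>- c / y\<close> minimises
      the form over all extensions of \<open>x\<close>, and the minimum is the form of
      \<open>Z\<close> at \<open>x\<close>. For \<open>y = 0\<close> it is 0.\<close>
    define x' where "x' = x(n := - c / y)"
    have "0 \<le> (\<Sum>i<Suc n. \<Sum>j<Suc n. x' i * Y i j * x' j)"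
      using Suc.prems unfolding psd_def by blast
    also have "\<dots> = (\<Sum>i<n. \<Sum>j<n. x' i * Y i j * x' j) + 2 * x' n * (\<Sum>i<n. x' i * Y i n) + (x' n)\<^sup>2 * y"
      unfolding y_def by (rule quad_form_Suc) (rule sym)
    also have "(\<Sum>i<n. x' i * Y i n) = c"
      unfolding c_def x'_def by (rule sum.cong) auto
    also have "(\<Sum>i<n. \<Sum>j<n. x' i * Y i j * x' j) = (\<Sum>i<n. \<Sum>j<n. x i * Y i j * x j)"
      unfolding x'_def by (intro sum.cong refl) auto
    also have "(\<Sum>i<n. \<Sum>j<n. x i * Y i j * x j) + 2 * x' n * c + (x' n)\<^sup>2 * y
        = (\<Sum>i<n. \<Sum>j<n. x i * Y i j * x j) - c * c / y"
      by (cases "y = 0") (auto simp: x'_def power2_eq_square field_simps)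
    also have "c * c = (\<Sum>i<n. \<Sum>j<n. (x i * Y i n) * (x j * Y j n))"
      unfolding c_def by (rule sum_product)
    finally show "0 \<le> (\<Sum>i<n. \<Sum>j<n. x i * Z i j * x j)"
      by (simp add: Z_def sum_subtractf sum_divide_distrib algebra_simps)
  qed
  then obtain V where V: "\<And>i j. i < n \<Longrightarrow> j < n \<Longrightarrow> Z i j = (\<Sum>k<n. V k i * V k j)"
    using Suc.IH by blast
  define U where "U k i = (if k < n then (if i < n then V k i else 0) else Y i n / sqrt y)" for k i
  have "Y i j = (\<Sum>k<Suc n. U k i * U k j)" if "i < Suc n" "j < Suc n" for i j
  proof -
    have sq: "U n i * U n j = Y i n * Y j n / y"
      using y0 by (simp add: U_def)
    show ?thesis
    proof (cases "i < n \<and> j < n")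
      case True
      have "(\<Sum>k<n. U k i * U k j) = (\<Sum>k<n. V k i * V k j)"
        by (rule sum.cong) (auto simp: U_def True)
      then show ?thesis using V[of i j] True sq by (simp add: Z_def)
    next
      case False
      have "(\<Sum>k<n. U k i * U k j) = 0"
        by (rule sum.neutral) (use False in \<open>auto simp: U_def\<close>)
      moreover have "Y i j = Y i n * Y j n / y"
      proof (cases "j = n")
        case True
        then show ?thesis using zero[of i] that by (cases "i = n"; cases "y = 0") (auto simp: y_def)
      next
        case False
        with \<open>\<not> (i < n \<and> j < n)\<close> that have "i = n" "j < n" by auto
        then show ?thesis using zero[of j] sym[of j] by (cases "y = 0") (auto simp: y_def)
      qed
      ultimately show ?thesis using sq by simp
    qed
  qed
  then show ?case by blast
qed

text \<open>Write a feasible \<open>Y\<close> as a Gram matrix and twist each row of the factor by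
  the labels. The gap between the objective values is then the sum over these rows of the Laplacian
  form of \<open>B\<close>, and \<open>cert\<close> makes that form positive on all nonconstant
  vectors.\<close>

lemma sdp_unique_optI:
  fixes A :: "nat \<Rightarrow> nat \<Rightarrow> real" and \<sigma> :: "nat \<Rightarrow> real"
  defines "B \<equiv> \<lambda>i j. \<sigma> i * \<sigma> j * A i j"
  assumes \<sigma>: "\<And>i. i < n \<Longrightarrow> \<sigma> i \<in> {-1, 1}"
    and sym: "\<And>i j. A i j = A j i"
    and cert: "\<And>u. (\<Sum>i<n. u i) = 0 \<Longrightarrow> \<exists>i<n. u i \<noteq> 0 \<Longrightarrow>
      (\<Sum>i<n. \<Sum>j<n. B i j * u i * u j) < (\<Sum>i<n. (\<Sum>j<n. B i j) * (u i)\<^sup>2)"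
  shows "sdp_unique_opt n A (\<lambda>i j. \<sigma> i * \<sigma> j)"
proof -
  have sq: "\<sigma> i * \<sigma> i = 1" if "i < n" for i using \<sigma>[OF that] by auto
  have Bsym: "B i j = B j i" for i j by (simp add: B_def sym[of i j])
  \<comment> \<open>The form of the Laplacian \<open>diag d - B\<close>, where \<open>d\<close> are
    the row sums of \<open>B\<close>. It is invariant under adding constants, so zero-sum vectors
    decide its sign.\<close>
  define E where "E u = (\<Sum>i<n. \<Sum>j<n. B i j * ((u i)\<^sup>2 - u i * u j))" for u
  have E_pos: "E u > 0" if "(\<Sum>i<n. u i) = 0" "\<exists>i<n. u i \<noteq> 0" for u
    using cert[OF that]
    by (simp add: E_def sum_subtractf right_diff_distrib sum_distrib_right mult.assoc)
  have E_shift: "E (\<lambda>i. u i - m) = E u" for u m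
  proof -
    have "E (\<lambda>i. u i - m) = (\<Sum>i<n. \<Sum>j<n. B i j * ((u i)\<^sup>2 - u i * u j) + (m * (B i j * u j) - m * (B i j * u i)))"
      unfolding E_def by (intro sum.cong refl) (simp add: power2_eq_square algebra_simps)
    also have "\<dots> = E u + ((\<Sum>i<n. \<Sum>j<n. m * (B i j * u j)) - (\<Sum>i<n. \<Sum>j<n. m * (B i j * u i)))"
      by (simp add: E_def sum.distrib sum_subtractf)
    also have "(\<Sum>i<n. \<Sum>j<n. m * (B i j * u j)) = (\<Sum>i<n. \<Sum>j<n. m * (B i j * u i))"
      by (subst sum.swap) (simp add: Bsym)
    finally show ?thesis by simp
  qed
  have E_const: "E u > 0 \<or> (\<exists>c. \<forall>i<n. u i = c) \<and> E u = 0" for u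
  proof (cases "n = 0")
    case True
    then show ?thesis by (simp add: E_def)
  next
    case False
    define m where "m = (\<Sum>i<n. u i) / n"
    have "(\<Sum>i<n. u i - m) = 0" using False by (simp add: sum_subtractf m_def)
    show ?thesis
    proof (cases "\<exists>i<n. u i - m \<noteq> 0")
      case True
      then show ?thesis using E_pos[of "\<lambda>i. u i - m"] \<open>(\<Sum>i<n. u i - m) = 0\<close> E_shift by simp
    next
      case False
      then have c: "\<forall>i<n. u i = m" by auto
      then have "E u = 0" by (simp add: E_def power2_eq_square)
      with c show ?thesis by blast
    qed
  qed
  have feas: "sdp_feasible n (\<lambda>i j. \<sigma> i * \<sigma> j)"
    unfolding sdp_feasible_def psd_def
  proof (intro conjI allI impI)
    fix x :: "nat \<Rightarrow> real"
    have "(\<Sum>i<n. \<Sum>j<n. x i * (\<sigma> i * \<sigma> j) * x j) = (\<Sum>i<n. x i * \<sigma> i) * (\<Sum>i<n. x i * \<sigma> i)"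
      by (simp add: sum_product algebra_simps)
    then show "0 \<le> (\<Sum>i<n. \<Sum>j<n. x i * (\<sigma> i * \<sigma> j) * x j)" by simp
  qed (auto simp: sq)
  have "frob_inner n A Y < frob_inner n A (\<lambda>i j. \<sigma> i * \<sigma> j)"
    if Y: "sdp_feasible n Y" "\<exists>i<n. \<exists>j<n. Y i j \<noteq> \<sigma> i * \<sigma> j" for Y
  proof -
    obtain V where V: "\<And>i j. i < n \<Longrightarrow> j < n \<Longrightarrow> Y i j = (\<Sum>k<n. V k i * V k j)"
      using psd_gram Y(1) unfolding sdp_feasible_def by blast
    have diag: "Y i i = 1" if "i < n" for i using Y(1) that by (auto simp: sdp_feasible_def)
    define u where "u k i = \<sigma> i * V k i" for k i
    \<comment> \<open>Summing over \<open>k\<close> turns products of factor entries into entries of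
      \<open>Y\<close>. As \<open>Y i i = 1\<close>, the diagonal part sums to the total of
      \<open>B\<close>, which is the objective value at the true labeling.\<close>
    have "(\<Sum>k<n. E (u k)) = (\<Sum>k<n. \<Sum>i<n. \<Sum>j<n. B i j * (V k i * V k i) - A i j * (V k i * V k j))"
      unfolding E_def
    proof (intro sum.cong refl, goal_cases)
      case (1 k i j)
      then have "\<sigma> i * \<sigma> i = 1" "\<sigma> j * \<sigma> j = 1" using sq by auto
      then show ?case unfolding u_def B_def power2_eq_square by algebra
    qed
    also have "\<dots> = (\<Sum>i<n. \<Sum>k<n. \<Sum>j<n. B i j * (V k i * V k i) - A i j * (V k i * V k j))"
      by (rule sum.swap)
    also have "\<dots> = (\<Sum>i<n. \<Sum>j<n. \<Sum>k<n. B i j * (V k i * V k i) - A i j * (V k i * V k j))"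
      by (rule sum.cong[OF refl], rule sum.swap)
    also have "\<dots> = (\<Sum>i<n. \<Sum>j<n. B i j * Y i i - A i j * Y i j)"
      by (intro sum.cong refl) (simp add: V sum_subtractf sum_distrib_left)
    also have "\<dots> = frob_inner n A (\<lambda>i j. \<sigma> i * \<sigma> j) - frob_inner n A Y"
      by (simp add: frob_inner_def sum_subtractf diag B_def mult.commute cong: sum.cong_simp)
    finally have eq: "(\<Sum>k<n. E (u k)) = frob_inner n A (\<lambda>i j. \<sigma> i * \<sigma> j) - frob_inner n A Y" .
    have nn: "E (u k) \<ge> 0" for k using E_const[of "u k"] by auto
    \<comment> \<open>A zero gap makes every twisted row constant, hence \<open>Y\<close> a multiple
      of the rank-one matrix of labels; the unit diagonal forces the multiple to be 1.\<close>
    have "(\<Sum>k<n. E (u k)) \<noteq> 0"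
    proof
      assume "(\<Sum>k<n. E (u k)) = 0"
      then have "\<forall>k<n. E (u k) = 0" using nn by (subst (asm) sum_nonneg_eq_0_iff) auto
      then have "\<forall>k<n. \<exists>c. \<forall>i<n. u k i = c" using E_const by (metis less_irrefl)
      then obtain c where c: "\<And>k i. k < n \<Longrightarrow> i < n \<Longrightarrow> u k i = c k" by metis
      have V': "V k i = \<sigma> i * c k" if "k < n" "i < n" for k i
        using c[OF that] sq[OF that(2)] unfolding u_def by (metis mult.assoc mult_1)
      have Y': "Y i j = \<sigma> i * \<sigma> j * (\<Sum>k<n. c k * c k)" if "i < n" "j < n" for i j
        using that by (simp add: V V' sum_distrib_left algebra_simps)
      from Y(2) obtain i j where ij: "i < n" "j < n" "Y i j \<noteq> \<sigma> i * \<sigma> j" by blast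
      have "(\<Sum>k<n. c k * c k) = 1" using Y'[of i i] diag[of i] sq[of i] ij(1) by simp
      with Y'[of i j] ij show False by simp
    qed
    moreover have "(\<Sum>k<n. E (u k)) \<ge> 0" by (simp add: sum_nonneg nn)
    ultimately show ?thesis using eq by linarith
  qed
  with feas show ?thesis unfolding sdp_unique_opt_def by blast
qed

subsection \<open>Deterministic bound on the quadratic form\<close>

text \<open>With zero diagonal the form is affine in each coordinate, so moving to one of the two
  neighbouring integers does not decrease it. The coordinates are treated in turn and each moves
  only once, hence by at most 1.\<close>

lemma integer_rounding_offdiag_form:
  fixes M :: "nat \<Rightarrow> nat \<Rightarrow> real" and u :: "nat \<Rightarrow> real"
  assumes diag: "\<And>i. M i i = 0"
  shows "\<exists>z :: nat \<Rightarrow> int. (\<forall>i<n. \<bar>z i - u i\<bar> \<le> 1) \<and>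
    (\<Sum>i<n. \<Sum>j<n. M i j * u i * u j) \<le> (\<Sum>i<n. \<Sum>j<n. M i j * z i * z j)"
proof -
  define f where "f u = (\<Sum>i<n. \<Sum>j<n. M i j * u i * u j)" for u :: "nat \<Rightarrow> real"
  have affine: "f (v(k := v k + s)) = f v + s * (\<Sum>j<n. (M k j + M j k) * v j)" if k: "k < n" for v :: "nat \<Rightarrow> real" and k s
  proof -
    define d :: "nat \<Rightarrow> real" where "d i = (if i = k then 1 else 0)" for i
    have upd: "(v(k := v k + s)) i = v i + s * d i" for i by (simp add: d_def)
    have "f (v(k := v k + s)) = (\<Sum>i<n. \<Sum>j<n. M i j * v i * v j + s * (d i * (M i j * v j)) + s * (d j * (M i j * v i)) + s * s * (d i * d j * M i j))"
      unfolding f_def upd by (simp add: algebra_simps)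
    also have "(\<Sum>i<n. \<Sum>j<n. M i j * v i * v j + s * (d i * (M i j * v j)) + s * (d j * (M i j * v i)) + s * s * (d i * d j * M i j))
      = f v + s * (\<Sum>i<n. \<Sum>j<n. d i * (M i j * v j)) + s * (\<Sum>i<n. \<Sum>j<n. d j * (M i j * v i)) + s * s * (\<Sum>i<n. \<Sum>j<n. d i * d j * M i j)"
      by (simp add: f_def sum.distrib sum_distrib_left)
    also have "(\<Sum>i<n. \<Sum>j<n. d i * (M i j * v j)) = (\<Sum>i<n. if i = k then (\<Sum>j<n. M k j * v j) else 0)"
      by (intro sum.cong refl) (auto simp: d_def)
    also have "\<dots> = (\<Sum>j<n. M k j * v j)" using k by simp
    also have "(\<Sum>i<n. \<Sum>j<n. d j * (M i j * v i)) = (\<Sum>i<n. M i k * v i)"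
    proof (intro sum.cong refl)
      fix i
      have "(\<Sum>j<n. d j * (M i j * v i)) = (\<Sum>j<n. if j = k then M i k * v i else 0)"
        by (intro sum.cong refl) (auto simp: d_def)
      then show "(\<Sum>j<n. d j * (M i j * v i)) = M i k * v i" using k by simp
    qed
    \<comment> \<open>The coefficient of \<open>s * s\<close> is the diagonal entry
      \<open>M k k\<close>.\<close>
    also have "(\<Sum>i<n. \<Sum>j<n. d i * d j * M i j) = 0"
      by (intro sum.neutral ballI) (auto simp: d_def diag)
    finally have "f (v(k := v k + s)) = f v + s * ((\<Sum>j<n. M k j * v j) + (\<Sum>j<n. M j k * v j))"
      by (simp only: distrib_left mult_zero_right add_0_right add.assoc)
    then show ?thesis by (simp only: sum.distrib distrib_right)
  qed
  have "\<exists>v :: nat \<Rightarrow> real. (\<forall>i<m. v i \<in> \<int>) \<and> (\<forall>i\<ge>m. v i = u i) \<and> (\<forall>i. \<bar>v i - u i\<bar> \<le> 1) \<and> f u \<le> f v" if "m \<le> n" for m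
    using that
  proof (induction m)
    case 0
    then show ?case by (intro exI[of _ u]) auto
  next
    case (Suc m)
    then obtain v where v: "\<forall>i<m. v i \<in> \<int>" "\<forall>i\<ge>m. v i = u i" "\<forall>i. \<bar>v i - u i\<bar> \<le> 1" "f u \<le> f v"
      by auto
    define b where "b = (\<Sum>j<n. (M m j + M j m) * v j)"
    \<comment> \<open>\<open>b\<close> is the slope in coordinate \<open>m\<close>, and the rounding
      goes in the direction of its sign.\<close>
    define t :: real where "t = (if b \<ge> 0 then of_int \<lceil>v m\<rceil> else of_int \<lfloor>v m\<rfloor>)"
    have "f (v(m := t)) = f v + (t - v m) * b"
      using affine[of m v "t - v m"] Suc.prems by (simp add: b_def)
    moreover have "(t - v m) * b \<ge> 0"
      by (cases "b \<ge> 0") (auto simp: t_def zero_le_mult_iff)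
    ultimately have "f u \<le> f (v(m := t))" using v(4) by linarith
    moreover have "t \<in> \<int>" "\<bar>t - u m\<bar> \<le> 1"
    proof -
      show "t \<in> \<int>" by (simp add: t_def)
      have "v m = u m" using v(2) by simp
      then show "\<bar>t - u m\<bar> \<le> 1" unfolding t_def by (simp, linarith)
    qed
    moreover define v' where "v' = v(m := t)"
    ultimately have "f u \<le> f v'" "\<forall>i<Suc m. v' i \<in> \<int>" "\<forall>i\<ge>Suc m. v' i = u i" "\<forall>i. \<bar>v' i - u i\<bar> \<le> 1"
      using v(1-3) by (auto simp: less_Suc_eq)
    then show ?case by blast
  qed
  from this[of n] obtain v where v: "\<forall>i<n. v i \<in> \<int>" "\<forall>i. \<bar>v i - u i\<bar> \<le> 1" "f u \<le> f v" by auto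
  define z where "z i = \<lfloor>v i\<rfloor>" for i
  have z: "real_of_int (z i) = v i" if "i < n" for i using v(1) that by (metis Ints_cases floor_of_int z_def)
  have "f v = (\<Sum>i<n. \<Sum>j<n. M i j * z i * z j)"
    unfolding f_def by (intro sum.cong refl) (simp add: z)
  then show ?thesis
    using v(2,3) z by (intro exI[of _ z]) (auto simp: f_def)
qed

lemma sum_weighted_min_le:
  fixes w :: "'a \<Rightarrow> 'a \<Rightarrow> real" and z :: "'a \<Rightarrow> real" and c :: real
  assumes "finite T"
    and "\<And>A. A \<subseteq> T \<Longrightarrow> (\<Sum>i\<in>A. \<Sum>j\<in>A. w i j) \<le> c * card A"
    and "\<And>i. i \<in> T \<Longrightarrow> z i \<ge> 0"
  shows "(\<Sum>i\<in>T. \<Sum>j\<in>T. w i j * min (z i) (z j)) \<le> c * (\<Sum>i\<in>T. z i)"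
  using assms
proof (induction "card T" arbitrary: T z rule: less_induct)
  case less
  show ?case
  proof (cases "T = {}")
    case True
    then show ?thesis by simp
  next
    case False
    define m where "m = Min (z ` T)"
    have m: "m \<le> z i" if "i \<in> T" for i using less.prems(1) that by (simp add: m_def)
    have "m \<in> z ` T" unfolding m_def using False less.prems(1) by (intro Min_in) auto
    then obtain i0 where i0: "i0 \<in> T" "z i0 = m" by auto
    then have m0: "m \<ge> 0" using less.prems(3) by auto
    \<comment> \<open>After subtracting \<open>m\<close>, the elements attaining the minimum
      contribute nothing, so the sum shrinks to \<open>T'\<close>.\<close>
    define T' where "T' = {i\<in>T. z i > m}"
    have T': "T' \<subseteq> T" "finite T'" using less.prems(1) by (auto simp: T'_def)
    have "T' \<subset> T" using i0 by (auto simp: T'_def)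
    then have "card T' < card T" using less.prems(1) by (rule psubset_card_mono[rotated])
    then have IH: "(\<Sum>i\<in>T'. \<Sum>j\<in>T'. w i j * min (z i - m) (z j - m)) \<le> c * (\<Sum>i\<in>T'. z i - m)"
      by (rule less.hyps) (use T' less.prems(2) m in auto)
    have "(\<Sum>i\<in>T. \<Sum>j\<in>T. w i j * min (z i) (z j))
        = (\<Sum>i\<in>T. \<Sum>j\<in>T. m * w i j + w i j * min (z i - m) (z j - m))"
      by (intro sum.cong refl) (auto simp: min_def algebra_simps)
    also have "\<dots> = m * (\<Sum>i\<in>T. \<Sum>j\<in>T. w i j) + (\<Sum>i\<in>T. \<Sum>j\<in>T. w i j * min (z i - m) (z j - m))"
      by (simp add: sum.distrib sum_distrib_left)
    also have "(\<Sum>i\<in>T. \<Sum>j\<in>T. w i j * min (z i - m) (z j - m))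
        = (\<Sum>i\<in>T'. \<Sum>j\<in>T'. w i j * min (z i - m) (z j - m))"
    proof -
      have "(\<Sum>j\<in>T. w i j * min (z i - m) (z j - m)) = (\<Sum>j\<in>T'. w i j * min (z i - m) (z j - m))" if "i \<in> T" for i
        using T' less.prems(1) m that
        by (intro sum.mono_neutral_right) (force simp: T'_def min_def)+
      then have "(\<Sum>i\<in>T. \<Sum>j\<in>T. w i j * min (z i - m) (z j - m)) = (\<Sum>i\<in>T. \<Sum>j\<in>T'. w i j * min (z i - m) (z j - m))"
        by simp
      also have "\<dots> = (\<Sum>i\<in>T'. \<Sum>j\<in>T'. w i j * min (z i - m) (z j - m))"
      proof (intro sum.mono_neutral_right ballI)
        fix i assume i: "i \<in> T - T'"
        then have "z i = m" using m[of i] by (auto simp: T'_def)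
        then show "(\<Sum>j\<in>T'. w i j * min (z i - m) (z j - m)) = 0"
          by (intro sum.neutral) (auto simp: T'_def)
      qed (use T' less.prems in auto)
      finally show ?thesis .
    qed
    also have "m * (\<Sum>i\<in>T. \<Sum>j\<in>T. w i j) \<le> m * (c * card T)"
      using less.prems(2)[of T] m0 by (intro mult_left_mono) auto
    also have "(\<Sum>i\<in>T'. \<Sum>j\<in>T'. w i j * min (z i - m) (z j - m)) \<le> c * (\<Sum>i\<in>T'. z i - m)"
      by (rule IH)
    also have "(\<Sum>i\<in>T'. z i - m) = (\<Sum>i\<in>T. z i - m)"
      using T' less.prems(1) m by (intro sum.mono_neutral_left) (force simp: T'_def)+
    finally show ?thesis
      by (simp add: sum_subtractf algebra_simps)
  qed
qed

text \<open>If the smaller entry is at most \<open>\<eta>\<close> times the larger one, the first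
  summand suffices and will be paid for by the degrees. Otherwise the entries are comparable: both
  squares are at least \<open>\<eta> * \<kappa>\<close> and the product is at most the smaller
  square divided by \<open>\<eta>\<close>. The part with \<open>q\<close> uses that a product
  exceeding \<open>\<kappa>\<close> is at most its square divided by
  \<open>\<kappa>\<close>.\<close>

lemma heavy_pair_bound:
  fixes b q \<kappa> \<eta> x y :: real
  assumes "\<eta> > 0" "\<kappa> > 0" "q \<ge> 0" "\<bar>x * y\<bar> > \<kappa>"
  shows "(b - q) * x * y \<le> \<eta> * (\<bar>b\<bar> * (x\<^sup>2 + y\<^sup>2)) +
     (if x\<^sup>2 \<ge> \<eta> * \<kappa> \<and> y\<^sup>2 \<ge> \<eta> * \<kappa> then \<bar>b\<bar> * min (x\<^sup>2) (y\<^sup>2) / \<eta> else 0) + q / \<kappa> * (x\<^sup>2 * y\<^sup>2)"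
proof -
  have main: "\<bar>x * y\<bar> \<le> \<eta> * (x\<^sup>2 + y\<^sup>2) +
     (if x\<^sup>2 \<ge> \<eta> * \<kappa> \<and> y\<^sup>2 \<ge> \<eta> * \<kappa> then min (x\<^sup>2) (y\<^sup>2) / \<eta> else 0)"
    if xy: "\<bar>y\<bar> \<le> \<bar>x\<bar>" "\<bar>x * y\<bar> > \<kappa>" for x y :: real
  proof (cases "\<bar>y\<bar> \<le> \<eta> * \<bar>x\<bar>")
    case True
    have "\<bar>x * y\<bar> \<le> \<bar>x\<bar> * (\<eta> * \<bar>x\<bar>)"
      unfolding abs_mult using True by (intro mult_left_mono) auto
    also have "\<dots> = \<eta> * x\<^sup>2" by (simp add: power2_eq_square)
    also have "\<dots> \<le> \<eta> * (x\<^sup>2 + y\<^sup>2)" using assms(1) by simp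
    finally have "\<bar>x * y\<bar> \<le> \<eta> * (x\<^sup>2 + y\<^sup>2)" .
    moreover have "0 \<le> min (x\<^sup>2) (y\<^sup>2) / \<eta>" using assms(1) by (simp add: min_def)
    ultimately show ?thesis by simp
  next
    case False
    have le: "y\<^sup>2 \<le> x\<^sup>2" using xy(1) by (simp add: abs_le_square_iff)
    have "\<bar>y\<bar> * (\<eta> * \<bar>x\<bar>) \<le> \<bar>y\<bar> * \<bar>y\<bar>" using False by (intro mult_left_mono) auto
    then have *: "\<eta> * \<bar>x * y\<bar> \<le> y\<^sup>2" by (simp add: abs_mult power2_eq_square algebra_simps)
    have "\<eta> * \<kappa> \<le> \<eta> * \<bar>x * y\<bar>" using xy(2) assms(1) by simp
    with * le have "y\<^sup>2 \<ge> \<eta> * \<kappa>" "x\<^sup>2 \<ge> \<eta> * \<kappa>" by linarith+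
    moreover have "\<bar>x * y\<bar> \<le> min (x\<^sup>2) (y\<^sup>2) / \<eta>"
      using * le assms(1) by (simp add: min_absorb2 pos_le_divide_eq mult.commute)
    moreover have "0 \<le> \<eta> * (x\<^sup>2 + y\<^sup>2)" using assms(1) by simp
    ultimately show ?thesis by simp
  qed
  have "\<bar>x * y\<bar> \<le> \<eta> * (x\<^sup>2 + y\<^sup>2) +
     (if x\<^sup>2 \<ge> \<eta> * \<kappa> \<and> y\<^sup>2 \<ge> \<eta> * \<kappa> then min (x\<^sup>2) (y\<^sup>2) / \<eta> else 0)" (is "_ \<le> ?R")
    using main[of y x] main[of x y] assms(4)
    by (cases "\<bar>y\<bar> \<le> \<bar>x\<bar>") (auto simp: mult.commute min.commute add.commute)
  then have 1: "\<bar>b\<bar> * \<bar>x * y\<bar> \<le> \<bar>b\<bar> * ?R" by (intro mult_left_mono) auto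
  have "\<kappa> * \<bar>x * y\<bar> \<le> \<bar>x * y\<bar> * \<bar>x * y\<bar>" using assms(4) by (intro mult_right_mono) auto
  also have "\<dots> = x\<^sup>2 * y\<^sup>2" by (simp add: power2_eq_square)
  finally have "\<bar>x * y\<bar> \<le> (x\<^sup>2 * y\<^sup>2) / \<kappa>"
    using assms(2) by (simp add: pos_le_divide_eq mult.commute)
  then have 2: "q * \<bar>x * y\<bar> \<le> q * ((x\<^sup>2 * y\<^sup>2) / \<kappa>)" using assms(3) by (intro mult_left_mono)
  have "(b - q) * x * y \<le> \<bar>(b - q) * x * y\<bar>" by simp
  also have "\<dots> = \<bar>b - q\<bar> * \<bar>x * y\<bar>" by (simp add: abs_mult)
  also have "\<dots> \<le> (\<bar>b\<bar> + q) * \<bar>x * y\<bar>" using assms(3) by (intro mult_right_mono) auto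
  also have "\<dots> \<le> \<bar>b\<bar> * ?R + q * ((x\<^sup>2 * y\<^sup>2) / \<kappa>)"
    using 1 2 by (simp add: distrib_right)
  finally show ?thesis by (auto simp: algebra_simps split: if_splits)
qed

text \<open>Here \<open>q\<close> stands for the mean of an off-diagonal entry. The centred form is
  rounded to integers and split into light pairs, unbalanced heavy pairs, comparable heavy pairs and
  the mean on heavy pairs. The four terms of \<open>sum_le\<close> are their shares, and
  \<open>row\<close> beats the total.\<close>

lemma certificate_of_regularity:
  fixes B :: "nat \<Rightarrow> nat \<Rightarrow> real" and u :: "nat \<Rightarrow> real"
    and q \<delta> \<eta> \<kappa> \<beta> K D :: real
  assumes sym: "\<And>i j. B i j = B j i" and diag: "\<And>i. B i i = 0"
    and pos: "q \<ge> 0" "\<eta> > 0" "\<kappa> > 0"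
    and row: "\<And>i. i < n \<Longrightarrow> (\<Sum>j<n. B i j) > D"
    and deg: "\<And>i. i < n \<Longrightarrow> (\<Sum>j<n. \<bar>B i j\<bar>) \<le> K"
    and sparse: "\<And>A. A \<subseteq> {..<n} \<Longrightarrow> \<eta> * \<kappa> * card A \<le> 4 * n \<Longrightarrow> (\<Sum>i\<in>A. \<Sum>j\<in>A. \<bar>B i j\<bar>) \<le> \<beta> * card A"
    and light: "\<And>z :: nat \<Rightarrow> int. (\<Sum>i<n. (z i)\<^sup>2) \<le> 4 * int n \<Longrightarrow>
      (\<Sum>i<n. \<Sum>j<n. if i \<noteq> j \<and> \<bar>real_of_int (z i) * z j\<bar> \<le> \<kappa> then (B i j - q) * z i * z j else 0) \<le> \<delta> * n"
    and \<beta>: "\<beta> \<ge> 0" and K: "K \<ge> 0"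
    and sum_le: "\<delta> + 8 * \<eta> * K + 4 * \<beta> / \<eta> + 16 * q * n / \<kappa> \<le> D"
    and u: "(\<Sum>i<n. u i) = 0" "\<exists>i<n. u i \<noteq> 0"
  shows "(\<Sum>i<n. \<Sum>j<n. B i j * u i * u j) < (\<Sum>i<n. (\<Sum>j<n. B i j) * (u i)\<^sup>2)"
proof -
  have n0: "n > 0" using u(2) by auto
  \<comment> \<open>Both sides are homogeneous of degree 2, so squared norm \<open>n\<close> may be
    assumed. At this scale, rounding each coordinate by at most 1 changes the norm only by a
    constant factor.\<close>
  have normalised: "(\<Sum>i<n. \<Sum>j<n. B i j * u i * u j) < (\<Sum>i<n. (\<Sum>j<n. B i j) * (u i)\<^sup>2)"
    if u0: "(\<Sum>i<n. u i) = 0" and un: "(\<Sum>i<n. (u i)\<^sup>2) = n" for u :: "nat \<Rightarrow> real"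
  proof -
    define M where "M i j = (if i = j then 0 else B i j - q)" for i j
    obtain z :: "nat \<Rightarrow> int" where z: "\<And>i. i < n \<Longrightarrow> \<bar>z i - u i\<bar> \<le> 1"
      and zM: "(\<Sum>i<n. \<Sum>j<n. M i j * u i * u j) \<le> (\<Sum>i<n. \<Sum>j<n. M i j * z i * z j)"
      using integer_rounding_offdiag_form[of M n u] by (auto simp: M_def)
    have zn: "(\<Sum>i<n. (real_of_int (z i))\<^sup>2) \<le> 4 * n"
    proof -
      have "(\<Sum>i<n. (real_of_int (z i))\<^sup>2) \<le> (\<Sum>i<n. 2 * (u i)\<^sup>2 + 2)"
      proof (rule sum_mono)
        fix i assume "i \<in> {..<n}"
        then have "(z i - u i)\<^sup>2 \<le> 1" using z[of i] by (simp add: abs_square_le_1)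
        \<comment> \<open>Used through the identity
          \<open>z^2 = 2 (z - u)^2 + 2 u^2 - (z - 2 u)^2\<close>.\<close>
        moreover have "0 \<le> (z i - 2 * u i)\<^sup>2" by simp
        ultimately show "(real_of_int (z i))\<^sup>2 \<le> 2 * (u i)\<^sup>2 + 2"
          by (simp add: power2_eq_square algebra_simps)
      qed
      also have "\<dots> = 4 * n" using un by (simp add: sum.distrib flip: sum_distrib_left)
      finally show ?thesis .
    qed
    have zn': "(\<Sum>i<n. (z i)\<^sup>2) \<le> 4 * int n"
    proof -
      have "real_of_int (\<Sum>i<n. (z i)\<^sup>2) \<le> real_of_int (4 * int n)" using zn by simp
      then show ?thesis by linarith
    qed
    \<comment> \<open>The vertices that can occur in a comparable heavy pair. As the squares sum to
      at most \<open>4 * n\<close>, every subset of \<open>T\<close> meets the size condition of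
      \<open>sparse\<close>.\<close>
    define T where "T = {i. i < n \<and> (real_of_int (z i))\<^sup>2 \<ge> \<eta> * \<kappa>}"
    have T: "T \<subseteq> {..<n}" "finite T" by (auto simp: T_def)
    have Tcard: "\<eta> * \<kappa> * card A \<le> 4 * n" if "A \<subseteq> T" for A
    proof -
      have "\<eta> * \<kappa> * card A = (\<Sum>i\<in>A. \<eta> * \<kappa>)" by simp
      also have "\<dots> \<le> (\<Sum>i\<in>A. (real_of_int (z i))\<^sup>2)" using that by (intro sum_mono) (auto simp: T_def)
      also have "\<dots> \<le> (\<Sum>i<n. (real_of_int (z i))\<^sup>2)" using that T by (intro sum_mono2) auto
      finally show ?thesis using zn by linarith
    qed
    \<comment> \<open>Light pairs (\<open>P1\<close>), unbalanced heavy pairs (\<open>P2\<close>),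
      comparable heavy pairs (\<open>P3\<close>) and the mean on heavy pairs (\<open>P4\<close>,
      whose double sum factorises).\<close>
    define P1 where "P1 i j = (if i \<noteq> j \<and> \<bar>real_of_int (z i) * z j\<bar> \<le> \<kappa> then (B i j - q) * z i * z j else 0)" for i j
    define P2 where "P2 i j = \<eta> * (\<bar>B i j\<bar> * (real_of_int (z i))\<^sup>2) + \<eta> * (\<bar>B i j\<bar> * (real_of_int (z j))\<^sup>2)" for i j
    define P3 where "P3 i j = (if i \<in> T \<and> j \<in> T then \<bar>B i j\<bar> * min ((real_of_int (z i))\<^sup>2) ((real_of_int (z j))\<^sup>2) else 0)" for i j
    define P4 where "P4 i j = (real_of_int (z i))\<^sup>2 * (real_of_int (z j))\<^sup>2" for i j
    have nn: "P2 i j \<ge> 0" "P3 i j \<ge> 0" "P4 i j \<ge> 0" for i j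
      using pos by (auto simp: P2_def P3_def P4_def)
    have "M i j * z i * z j \<le> P1 i j + P2 i j + P3 i j / \<eta> + q / \<kappa> * P4 i j" if "i < n" "j < n" for i j
    proof (cases "i \<noteq> j \<and> \<bar>real_of_int (z i) * z j\<bar> > \<kappa>")
      case True
      then show ?thesis
        using heavy_pair_bound[OF pos(2,3,1), of "z i" "z j" "B i j"] that
        by (auto simp: P1_def P2_def P3_def P4_def T_def M_def distrib_left split: if_splits)
    next
      case False
      then have "M i j * z i * z j = P1 i j" by (auto simp: M_def P1_def)
      moreover have "0 \<le> P3 i j / \<eta>" "0 \<le> q / \<kappa> * P4 i j" using nn[of i j] pos by auto
      ultimately show ?thesis using nn(1)[of i j] by linarith
    qed
    then have "(\<Sum>i<n. \<Sum>j<n. M i j * z i * z j) \<le> (\<Sum>i<n. \<Sum>j<n. P1 i j + P2 i j + P3 i j / \<eta> + q / \<kappa> * P4 i j)"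
      by (intro sum_mono) auto
    also have "\<dots> = (\<Sum>i<n. \<Sum>j<n. P1 i j) + (\<Sum>i<n. \<Sum>j<n. P2 i j) + (\<Sum>i<n. \<Sum>j<n. P3 i j) / \<eta> + q / \<kappa> * (\<Sum>i<n. \<Sum>j<n. P4 i j)"
      by (simp add: sum.distrib sum_distrib_left sum_divide_distrib)
    also have "(\<Sum>i<n. \<Sum>j<n. P1 i j) \<le> \<delta> * n"
      unfolding P1_def by (rule light[OF zn'])
    also have "(\<Sum>i<n. \<Sum>j<n. P2 i j) \<le> 8 * \<eta> * K * n"
    proof -
      have "(\<Sum>i<n. \<Sum>j<n. \<bar>B i j\<bar> * (real_of_int (z j))\<^sup>2) = (\<Sum>i<n. \<Sum>j<n. \<bar>B i j\<bar> * (real_of_int (z i))\<^sup>2)"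
        by (subst sum.swap) (simp add: sym)
      then have "(\<Sum>i<n. \<Sum>j<n. P2 i j) = 2 * \<eta> * (\<Sum>i<n. \<Sum>j<n. \<bar>B i j\<bar> * (real_of_int (z i))\<^sup>2)"
        by (simp add: P2_def sum.distrib flip: sum_distrib_left)
      also have "(\<Sum>i<n. \<Sum>j<n. \<bar>B i j\<bar> * (real_of_int (z i))\<^sup>2) = (\<Sum>i<n. (\<Sum>j<n. \<bar>B i j\<bar>) * (real_of_int (z i))\<^sup>2)"
        by (simp add: sum_distrib_right)
      also have "\<dots> \<le> (\<Sum>i<n. K * (real_of_int (z i))\<^sup>2)"
        using deg by (intro sum_mono mult_right_mono) auto
      also have "\<dots> \<le> K * (4 * n)"
        using zn K by (simp add: mult_left_mono flip: sum_distrib_left)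
      finally show ?thesis using pos by (simp add: algebra_simps)
    qed
    also have "(\<Sum>i<n. \<Sum>j<n. P3 i j) \<le> 4 * \<beta> * n"
    proof -
      have "(\<Sum>j<n. P3 i j) = (\<Sum>j\<in>T. P3 i j)" for i
        using T by (intro sum.mono_neutral_right) (auto simp: P3_def)
      moreover have "(\<Sum>i<n. \<Sum>j\<in>T. P3 i j) = (\<Sum>i\<in>T. \<Sum>j\<in>T. P3 i j)"
        using T by (intro sum.mono_neutral_right) (auto simp: P3_def)
      ultimately have "(\<Sum>i<n. \<Sum>j<n. P3 i j) = (\<Sum>i\<in>T. \<Sum>j\<in>T. P3 i j)" by simp
      also have "\<dots> = (\<Sum>i\<in>T. \<Sum>j\<in>T. \<bar>B i j\<bar> * min ((real_of_int (z i))\<^sup>2) ((real_of_int (z j))\<^sup>2))"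
        by (simp add: P3_def)
      also have "\<dots> \<le> \<beta> * (\<Sum>i\<in>T. (real_of_int (z i))\<^sup>2)"
        using T Tcard by (intro sum_weighted_min_le sparse) auto
      also have "\<dots> \<le> \<beta> * (\<Sum>i<n. (real_of_int (z i))\<^sup>2)"
        using T \<beta> by (intro mult_left_mono sum_mono2) auto
      also have "\<dots> \<le> \<beta> * (4 * n)" using zn \<beta> by (rule mult_left_mono)
      finally show ?thesis by simp
    qed
    also have "(\<Sum>i<n. \<Sum>j<n. P4 i j) \<le> (4 * real n) * (4 * real n)"
    proof -
      have "(\<Sum>i<n. \<Sum>j<n. P4 i j) = (\<Sum>i<n. (real_of_int (z i))\<^sup>2) * (\<Sum>i<n. (real_of_int (z i))\<^sup>2)"
        by (simp add: P4_def sum_product)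
      also have "\<dots> \<le> (4 * real n) * (4 * real n)"
        using zn by (intro mult_mono) (auto intro: sum_nonneg)
      finally show ?thesis .
    qed
    finally have bound: "(\<Sum>i<n. \<Sum>j<n. M i j * z i * z j) \<le> 
        \<delta> * n + 8 * \<eta> * K * n + 4 * \<beta> * n / \<eta> + q / \<kappa> * (4 * real n * (4 * real n))"
      using pos by (simp add: divide_right_mono mult_left_mono)
    also have "\<dots> = (\<delta> + 8 * \<eta> * K + 4 * \<beta> / \<eta> + 16 * q * n / \<kappa>) * n"
      by (simp add: algebra_simps)
    also have "\<dots> \<le> D * n" using sum_le by (intro mult_right_mono) auto
    finally have "(\<Sum>i<n. \<Sum>j<n. M i j * u i * u j) \<le> D * n" using zM by linarith
    moreover have "(\<Sum>i<n. \<Sum>j<n. B i j * u i * u j) \<le> (\<Sum>i<n. \<Sum>j<n. M i j * u i * u j)"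
    proof -
      \<comment> \<open>Subtracting \<open>q\<close> also on the diagonal costs nothing since
        \<open>u\<close> sums to zero; restoring the diagonal adds \<open>q * n\<close>, which has
        the favourable sign.\<close>
      have "(\<Sum>i<n. \<Sum>j<n. M i j * u i * u j) = 
        (\<Sum>i<n. \<Sum>j<n. B i j * u i * u j - q * (u i * u j) + (if j = i then q * (u i)\<^sup>2 else 0))"
        by (intro sum.cong refl) (auto simp: M_def diag power2_eq_square algebra_simps)
      also have "\<dots> = (\<Sum>i<n. \<Sum>j<n. B i j * u i * u j) - q * ((\<Sum>i<n. u i) * (\<Sum>i<n. u i)) + q * (\<Sum>i<n. (u i)\<^sup>2)"
        unfolding sum_product by (simp add: sum.distrib sum_subtractf sum_distrib_left)
      finally show ?thesis using u0 un pos by simp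
    qed
    moreover have "D * n < (\<Sum>i<n. (\<Sum>j<n. B i j) * (u i)\<^sup>2)"
    proof -
      have "\<exists>i<n. u i \<noteq> 0"
      proof (rule ccontr)
        assume "\<not> ?thesis"
        then have "(\<Sum>i<n. (u i)\<^sup>2) = 0" by simp
        then show False using un n0 by simp
      qed
      then obtain k where k: "k < n" "u k \<noteq> 0" by blast
      have "D * n = (\<Sum>i<n. D * (u i)\<^sup>2)" using un by (simp flip: sum_distrib_left)
      also have "\<dots> < (\<Sum>i<n. (\<Sum>j<n. B i j) * (u i)\<^sup>2)"
      proof (rule sum_strict_mono_ex1)
        show "\<forall>i\<in>{..<n}. D * (u i)\<^sup>2 \<le> (\<Sum>j<n. B i j) * (u i)\<^sup>2"
          using row by (auto intro!: mult_right_mono simp: less_imp_le)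
        show "\<exists>i\<in>{..<n}. D * (u i)\<^sup>2 < (\<Sum>j<n. B i j) * (u i)\<^sup>2"
          using row[OF k(1)] k by (intro bexI[of _ k]) auto
      qed simp
      finally show ?thesis .
    qed
    ultimately show ?thesis by linarith
  qed
  define S where "S = (\<Sum>i<n. (u i)\<^sup>2)"
  have S: "S > 0"
    using u(2) unfolding S_def by (auto intro: sum_pos2)
  define r where "r = sqrt (n / S)"
  have r: "r > 0" "r\<^sup>2 = n / S" using S n0 by (auto simp: r_def)
  have "(\<Sum>i<n. \<Sum>j<n. B i j * (r * u i) * (r * u j)) < (\<Sum>i<n. (\<Sum>j<n. B i j) * (r * u i)\<^sup>2)"
  proof (rule normalised)
    show "(\<Sum>i<n. r * u i) = 0" using u(1) by (simp flip: sum_distrib_left)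
    show "(\<Sum>i<n. (r * u i)\<^sup>2) = n"
    proof -
      have "(\<Sum>i<n. (r * u i)\<^sup>2) = r\<^sup>2 * S"
        by (simp add: power_mult_distrib S_def sum_distrib_left)
      then show ?thesis using S r by simp
    qed
  qed
  also have "(\<Sum>i<n. (\<Sum>j<n. B i j) * (r * u i)\<^sup>2) = r\<^sup>2 * (\<Sum>i<n. (\<Sum>j<n. B i j) * (u i)\<^sup>2)"
    by (simp add: sum_distrib_left power_mult_distrib mult_ac)
  also have "(\<Sum>i<n. \<Sum>j<n. B i j * (r * u i) * (r * u j)) = r\<^sup>2 * (\<Sum>i<n. \<Sum>j<n. B i j * u i * u j)"
    by (simp add: sum_distrib_left power2_eq_square mult_ac)
  finally show ?thesis using r(1) by simp
qed

subsection \<open>Chernoff bounds\<close>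

lemma finite_cbm_pairs [simp]: "finite (cbm_pairs n)"
  by (rule finite_subset[of _ "{..<n} \<times> {..<n}"]) (auto simp: cbm_pairs_def)

text \<open>Translates quadratic forms, written as double sums, into sums over the independent
  entries, which are indexed by pairs \<open>i < j\<close>.\<close>

lemma sum_symmetric_eq_sum_cbm_pairs:
  fixes F :: "nat \<Rightarrow> nat \<Rightarrow> real"
  assumes "\<And>i j. F i j = F j i" "\<And>i. F i i = 0"
  shows "(\<Sum>i<n. \<Sum>j<n. F i j) = 2 * (\<Sum>(i,j)\<in>cbm_pairs n. F i j)"
proof (induction n)
  case 0
  then show ?case by (simp add: cbm_pairs_def)
next
  case (Suc n)
  have "cbm_pairs (Suc n) = cbm_pairs n \<union> (\<lambda>i. (i, n)) ` {..<n}"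
    by (auto simp: cbm_pairs_def less_Suc_eq)
  moreover have "cbm_pairs n \<inter> (\<lambda>i. (i, n)) ` {..<n} = {}"
    by (auto simp: cbm_pairs_def)
  moreover have "(\<Sum>(i,j)\<in>(\<lambda>i. (i, n)) ` {..<n}. F i j) = (\<Sum>i<n. F i n)"
    by (subst sum.reindex) (auto simp: inj_on_def)
  ultimately have "(\<Sum>(i,j)\<in>cbm_pairs (Suc n). F i j) = (\<Sum>(i,j)\<in>cbm_pairs n. F i j) + (\<Sum>i<n. F i n)"
    by (simp add: sum.union_disjoint)
  moreover have "(\<Sum>j<n. F n j) = (\<Sum>i<n. F i n)" by (simp add: assms(1)[of n])
  ultimately show ?case using Suc by (simp add: sum.distrib assms(2))
qed

lemma row_sum_eq_sum_cbm_pairs: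
  fixes F :: "nat \<Rightarrow> nat \<Rightarrow> real"
  assumes "\<And>i j. F i j = F j i" "\<And>i. F i i = 0" "i < n"
  shows "(\<Sum>j<n. F i j) = (\<Sum>(k,l)\<in>cbm_pairs n. if k = i \<or> l = i then F k l else 0)"
proof -
  have "(\<Sum>j<n. F i j) = (\<Sum>j\<in>{..<n} - {i}. F i j)"
    using assms by (intro sum.mono_neutral_right) auto
  also have "\<dots> = (\<Sum>(k,l)\<in>{e \<in> cbm_pairs n. fst e = i \<or> snd e = i}. F k l)"
    by (rule sum.reindex_bij_witness[of _ "\<lambda>(k,l). if k = i then l else k" "\<lambda>j. if j < i then (j, i) else (i, j)"])
       (use assms in \<open>auto simp: cbm_pairs_def split: if_splits\<close>)
  also have "\<dots> = (\<Sum>(k,l)\<in>cbm_pairs n. if k = i \<or> l = i then F k l else 0)"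
    by (rule sum.mono_neutral_cong_left) (auto split: if_splits)
  finally show ?thesis .
qed

lemma card_cbm_pairs_incident:
  assumes "i < n"
  shows "(\<Sum>(k,l)\<in>cbm_pairs n. if k = i \<or> l = i then c else 0) = (real n - 1) * c"
proof -
  \<comment> \<open>The inner conditional gives the summand the zero diagonal that the row-sum
    identity asks for; it changes nothing on pairs with \<open>k < l\<close>.\<close>
  have "(\<Sum>(k,l)\<in>cbm_pairs n. if k = i \<or> l = i then c else 0)
      = (\<Sum>(k,l)\<in>cbm_pairs n. if k = i \<or> l = i then (if k = l then 0 else c) else 0)"
    by (intro sum.cong refl) (auto simp: cbm_pairs_def)
  also have "\<dots> = (\<Sum>j<n. if i = j then 0 else c)"
    using assms by (subst row_sum_eq_sum_cbm_pairs[symmetric]) auto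
  also have "\<dots> = (\<Sum>j\<in>{..<n} - {i}. c)"
    by (rule sum.mono_neutral_cong_right) auto
  also have "\<dots> = (real n - 1) * c" using assms by (simp add: of_nat_diff)
  finally show ?thesis .
qed

section \<open>Moment generating functions of a single entry\<close>

lemma set_pmf_cbm_entry: "set_pmf (cbm_entry_pmf p eps s) \<subseteq> {0, s, -s}"
  by (auto simp: cbm_entry_pmf_def split: if_splits)

lemma finite_set_pmf_cbm_entry [simp]: "finite (set_pmf (cbm_entry_pmf p eps s))"
  by (rule finite_subset[OF set_pmf_cbm_entry]) simp

lemma expectation_cbm_entry:
  fixes f :: "real \<Rightarrow> real"
  assumes "0 \<le> p" "p \<le> 1" "0 \<le> eps" "eps \<le> 1"
  shows "measure_pmf.expectation (cbm_entry_pmf p eps s) f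
    = (1 - p) * f 0 + p * ((1 - eps) * f s + eps * f (- s))"
  unfolding cbm_entry_pmf_def
  by (subst pmf_expectation_bind[of UNIV])
     (use assms in \<open>auto simp: UNIV_bool algebra_simps\<close>)

text \<open>For negative \<open>x = - y\<close> it follows from
  \<open>exp x \<le> 1 / (1 + y)\<close> and \<open>(1 - y + y^2) (1 + y) = 1 + y^3\<close>.\<close>

lemma exp_le_quadratic:
  fixes x :: real
  assumes "\<bar>x\<bar> \<le> 1"
  shows "exp x \<le> 1 + x + x\<^sup>2"
proof (cases "x \<ge> 0")
  case True
  then show ?thesis using assms by (intro exp_bound) auto
next
  case False
  define y where "y = - x"
  have y: "0 < y" "y \<le> 1" using False assms by (auto simp: y_def)
  have "1 + y \<le> exp y" by (rule exp_ge_add_one_self)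
  then have "exp x \<le> 1 / (1 + y)"
    using y by (simp add: y_def exp_minus field_simps)
  also have "\<dots> \<le> 1 - y + y\<^sup>2"
  proof -
    have "1 \<le> (1 - y + y\<^sup>2) * (1 + y)" using y by (simp add: algebra_simps power2_eq_square)
    then show ?thesis using y by (simp add: pos_divide_le_eq)
  qed
  finally show ?thesis by (simp add: y_def)
qed

context
  fixes p eps s :: real
  assumes p: "0 \<le> p" "p \<le> 1" and eps: "0 \<le> eps" "eps \<le> 1" and s: "s \<in> {-1, 1}"
begin

lemma mgf_cbm_entry_signed:
  "measure_pmf.expectation (cbm_entry_pmf p eps s) (\<lambda>w. exp (x * (s * w)))
    \<le> exp (p * ((1 - eps) * exp x + eps * exp (- x) - 1))"
proof -
  have "s * s = 1" using s by auto
  then have "measure_pmf.expectation (cbm_entry_pmf p eps s) (\<lambda>w. exp (x * (s * w)))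
      = 1 + p * ((1 - eps) * exp x + eps * exp (- x) - 1)"
    by (subst expectation_cbm_entry) (use p eps in \<open>auto simp: algebra_simps\<close>)
  then show ?thesis by (simp add: exp_ge_add_one_self)
qed

lemma mgf_cbm_entry_abs:
  "measure_pmf.expectation (cbm_entry_pmf p eps s) (\<lambda>w. exp (x * \<bar>w\<bar>)) \<le> exp (p * (exp x - 1))"
proof -
  have "\<bar>s\<bar> = 1" using s by auto
  then have "measure_pmf.expectation (cbm_entry_pmf p eps s) (\<lambda>w. exp (x * \<bar>w\<bar>)) = 1 + p * (exp x - 1)"
    by (subst expectation_cbm_entry) (use p eps in \<open>auto simp: algebra_simps\<close>)
  then show ?thesis by (simp add: exp_ge_add_one_self)
qed

text \<open>Centring cancels the first-order terms, leaving a sub-Gaussian bound on the range where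
  \<open>exp\<close> has a quadratic upper bound.\<close>

lemma mgf_cbm_entry_centred:
  assumes "\<bar>x\<bar> \<le> 1"
  shows "measure_pmf.expectation (cbm_entry_pmf p eps s) (\<lambda>w. exp (x * (s * w - p * (1 - 2 * eps))))
    \<le> exp (p * x\<^sup>2)"
proof -
  have "measure_pmf.expectation (cbm_entry_pmf p eps s) (\<lambda>w. exp (x * (s * w - p * (1 - 2 * eps))))
      = measure_pmf.expectation (cbm_entry_pmf p eps s) (\<lambda>w. exp (x * (s * w)) * exp (- x * p * (1 - 2 * eps)))"
    by (simp add: algebra_simps flip: exp_add)
  also have "\<dots> = measure_pmf.expectation (cbm_entry_pmf p eps s) (\<lambda>w. exp (x * (s * w))) * exp (- x * p * (1 - 2 * eps))"
    by simp
  also have "\<dots> \<le> exp (p * ((1 - eps) * exp x + eps * exp (- x) - 1)) * exp (- x * p * (1 - 2 * eps))"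
    by (intro mult_right_mono mgf_cbm_entry_signed) simp
  also have "\<dots> = exp (p * ((1 - eps) * exp x + eps * exp (- x) - 1 - x * (1 - 2 * eps)))"
    by (simp add: algebra_simps flip: exp_add)
  also have "\<dots> \<le> exp (p * x\<^sup>2)"
  proof -
    have "(1 - eps) * exp x + eps * exp (- x) \<le> (1 - eps) * (1 + x + x\<^sup>2) + eps * (1 + (- x) + (- x)\<^sup>2)"
      using assms eps by (intro add_mono mult_left_mono exp_le_quadratic) auto
    also have "\<dots> = 1 + x * (1 - 2 * eps) + x\<^sup>2" by (simp add: algebra_simps)
    finally show ?thesis using p by (auto intro!: mult_left_mono)
  qed
  finally show ?thesis .
qed

end

text \<open>Markov's inequality for the exponential of the sum, whose expectation factorises by
  independence. Finite supports supply integrability.\<close>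

lemma chernoff_Pi_pmf:
  fixes g :: "'a \<Rightarrow> 'b \<Rightarrow> real"
  assumes "finite P" "\<And>e. e \<in> P \<Longrightarrow> finite (set_pmf (Q e))"
    and mgf: "\<And>e. e \<in> P \<Longrightarrow> measure_pmf.expectation (Q e) (\<lambda>w. exp (g e w)) \<le> exp (c e)"
    and C: "(\<Sum>e\<in>P. c e) \<le> C"
  shows "measure_pmf.prob (Pi_pmf P d Q) {W. (\<Sum>e\<in>P. g e (W e)) \<ge> t} \<le> exp (C - t)"
proof -
  define u where "u W = exp (\<Sum>e\<in>P. g e (W e))" for W
  have fin: "finite (set_pmf (Pi_pmf P d Q))"
    using assms(1,2) by (subst set_Pi_pmf) (auto intro!: finite_PiE_dflt)
  have "measure_pmf.prob (Pi_pmf P d Q) {W. (\<Sum>e\<in>P. g e (W e)) \<ge> t}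
      = measure_pmf.prob (Pi_pmf P d Q) {W \<in> space (measure_pmf (Pi_pmf P d Q)). u W \<ge> exp t}"
    by (simp add: u_def)
  also have "\<dots> \<le> measure_pmf.expectation (Pi_pmf P d Q) u / exp t"
    by (rule integral_Markov_inequality_measure[where A = "{}"])
       (auto simp: u_def intro!: integrable_measure_pmf_finite fin)
  also have "measure_pmf.expectation (Pi_pmf P d Q) u = (\<Prod>e\<in>P. measure_pmf.expectation (Q e) (\<lambda>w. exp (g e w)))"
    unfolding u_def exp_sum[OF assms(1)]
    by (rule expectation_prod_Pi_pmf) (use assms in \<open>auto intro!: integrable_measure_pmf_finite\<close>)
  also have "\<dots> \<le> (\<Prod>e\<in>P. exp (c e))"
    by (intro prod_mono conjI mgf) auto
  also have "\<dots> = exp (\<Sum>e\<in>P. c e)" by (simp add: exp_sum[OF assms(1)])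
  also have "\<dots> \<le> exp C" using C by simp
  finally show ?thesis by (simp add: exp_diff divide_right_mono)
qed

text \<open>Conjugation by the true labels: for labels in {-1, 1} the entries above the diagonal
  become identically distributed with mean \<open>p * (1 - 2 * eps)\<close>, and the planted vector
  becomes constant.\<close>

definition cbm_signed :: "(nat \<Rightarrow> real) \<Rightarrow> (nat \<times> nat \<Rightarrow> real) \<Rightarrow> nat \<Rightarrow> nat \<Rightarrow> real" where
  "cbm_signed \<sigma> W i j = \<sigma> i * \<sigma> j * cbm_adj W i j"

lemma cbm_signed_sym: "cbm_signed \<sigma> W i j = cbm_signed \<sigma> W j i"
  by (auto simp: cbm_signed_def cbm_adj_def)

lemma cbm_signed_diag [simp]: "cbm_signed \<sigma> W i i = 0"
  by (simp add: cbm_signed_def cbm_adj_def)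

lemma cbm_signed_pair: "(i, j) \<in> cbm_pairs n \<Longrightarrow> cbm_signed \<sigma> W i j = \<sigma> i * \<sigma> j * W (i, j)"
  by (simp add: cbm_signed_def cbm_adj_def cbm_pairs_def)

section \<open>Tail bounds for one row, one vertex set and one integer vector\<close>

locale cbm =
  fixes n :: nat and p eps :: real and \<sigma> :: "nat \<Rightarrow> real"
  assumes p: "0 \<le> p" "p \<le> 1" and eps: "0 \<le> eps" "eps \<le> 1"
    and \<sigma>: "\<And>i. i < n \<Longrightarrow> \<sigma> i \<in> {-1, 1}"
begin

abbreviation "Pr \<equiv> measure_pmf.prob (cbm_pmf n p eps \<sigma>)"
abbreviation "B \<equiv> cbm_signed \<sigma>"

lemma sign_pair: "(i, j) \<in> cbm_pairs n \<Longrightarrow> \<sigma> i * \<sigma> j \<in> {-1, 1}"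
  using \<sigma>[of i] \<sigma>[of j] by (auto simp: cbm_pairs_def)

lemma abs_signed_pair: "(i, j) \<in> cbm_pairs n \<Longrightarrow> \<bar>B W i j\<bar> = \<bar>W (i, j)\<bar>"
  using sign_pair[of i j] by (auto simp: cbm_signed_pair)

lemma chernoff:
  assumes "\<And>i j. (i, j) \<in> cbm_pairs n \<Longrightarrow>
      measure_pmf.expectation (cbm_entry_pmf p eps (\<sigma> i * \<sigma> j)) (\<lambda>w. exp (g i j w)) \<le> exp (c i j)"
    and "(\<Sum>(i,j)\<in>cbm_pairs n. c i j) \<le> C"
    and "\<And>W. W \<in> S \<Longrightarrow> t \<le> (\<Sum>(i,j)\<in>cbm_pairs n. g i j (W (i, j)))"
  shows "Pr S \<le> exp (C - t)"
proof -
  have "Pr S \<le> Pr {W. (\<Sum>e\<in>cbm_pairs n. (case e of (i,j) \<Rightarrow> g i j) (W e)) \<ge> t}"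
    using assms(3) by (intro measure_pmf.finite_measure_mono) (auto simp: case_prod_beta)
  also have "\<dots> \<le> exp (C - t)"
    unfolding cbm_pmf_def
    by (rule chernoff_Pi_pmf[where c = "\<lambda>(i,j). c i j"]) (use assms in auto)
  finally show ?thesis .
qed

text \<open>The lower tail is tilted by \<open>- x\<close>. The parameter stays free because it must
  be nearly optimal for the bound to survive a union over \<open>n\<close> rows at the sharp
  threshold.\<close>

lemma prob_row_sum_le:
  assumes i: "i < n" and x: "x \<ge> 0"
  shows "Pr {W. (\<Sum>j<n. B W i j) \<le> D}
    \<le> exp (x * D - p * (real n - 1) * (1 - (1 - eps) * exp (- x) - eps * exp x))"
proof -
  define c where "c = p * ((1 - eps) * exp (- x) + eps * exp x - 1)"
  have "Pr {W. (\<Sum>j<n. B W i j) \<le> D} \<le> exp ((real n - 1) * c - (- (x * D)))"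
  proof (rule chernoff[where g = "\<lambda>k l w. if k = i \<or> l = i then - x * (\<sigma> k * \<sigma> l * w) else 0"
        and c = "\<lambda>k l. if k = i \<or> l = i then c else 0"])
    fix k l assume kl: "(k, l) \<in> cbm_pairs n"
    show "measure_pmf.expectation (cbm_entry_pmf p eps (\<sigma> k * \<sigma> l))
        (\<lambda>w. exp (if k = i \<or> l = i then - x * (\<sigma> k * \<sigma> l * w) else 0)) \<le> exp (if k = i \<or> l = i then c else 0)"
      using mgf_cbm_entry_signed[OF p eps sign_pair[OF kl], of "-x"] by (simp add: c_def)
  next
    show "(\<Sum>(k,l)\<in>cbm_pairs n. if k = i \<or> l = i then c else 0) \<le> (real n - 1) * c"
      using card_cbm_pairs_incident[OF i] by simp
  next
    fix W assume W: "W \<in> {W. (\<Sum>j<n. B W i j) \<le> D}"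
    have "(\<Sum>(k,l)\<in>cbm_pairs n. if k = i \<or> l = i then - x * (\<sigma> k * \<sigma> l * W (k, l)) else 0)
        = (\<Sum>(k,l)\<in>cbm_pairs n. if k = i \<or> l = i then - x * B W k l else 0)"
      by (intro sum.cong refl) (auto simp: cbm_signed_pair)
    also have "\<dots> = (\<Sum>j<n. - x * B W i j)"
      using i by (subst row_sum_eq_sum_cbm_pairs) (auto simp: cbm_signed_sym)
    also have "\<dots> = - (x * (\<Sum>j<n. B W i j))" by (simp add: sum_distrib_left sum_negf)
    also have "\<dots> \<ge> - (x * D)" using W x by (simp add: mult_left_mono)
    finally show "- (x * D) \<le> (\<Sum>(k,l)\<in>cbm_pairs n. if k = i \<or> l = i then - x * (\<sigma> k * \<sigma> l * W (k, l)) else 0)" .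
  qed
  then show ?thesis by (simp add: c_def algebra_simps)
qed

lemma prob_degree_ge:
  assumes i: "i < n"
  shows "Pr {W. (\<Sum>j<n. \<bar>B W i j\<bar>) \<ge> D} \<le> exp (2 * p * n - D)"
proof (rule chernoff[where g = "\<lambda>k l w. if k = i \<or> l = i then \<bar>w\<bar> else 0"
      and c = "\<lambda>k l. if k = i \<or> l = i then p * (exp 1 - 1) else 0"])
  fix k l assume kl: "(k, l) \<in> cbm_pairs n"
  show "measure_pmf.expectation (cbm_entry_pmf p eps (\<sigma> k * \<sigma> l))
      (\<lambda>w. exp (if k = i \<or> l = i then \<bar>w\<bar> else 0)) \<le> exp (if k = i \<or> l = i then p * (exp 1 - 1) else 0)"
    using mgf_cbm_entry_abs[OF p eps sign_pair[OF kl], of 1] by simp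
next
  \<comment> \<open>Tilt 1 is enough for the degrees; the factor 2 bounds
    \<open>exp 1 - 1\<close>.\<close>
  have "(real n - 1) * (p * (exp 1 - 1)) \<le> n * (p * 2)"
    using exp_le p i by (intro mult_mono) auto
  then show "(\<Sum>(k,l)\<in>cbm_pairs n. if k = i \<or> l = i then p * (exp 1 - 1) else 0) \<le> 2 * p * n"
    unfolding card_cbm_pairs_incident[OF i] by (simp add: mult_ac)
next
  fix W assume W: "W \<in> {W. (\<Sum>j<n. \<bar>B W i j\<bar>) \<ge> D}"
  have "(\<Sum>(k,l)\<in>cbm_pairs n. if k = i \<or> l = i then \<bar>W (k, l)\<bar> else 0)
      = (\<Sum>(k,l)\<in>cbm_pairs n. if k = i \<or> l = i then \<bar>B W k l\<bar> else 0)"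
    by (intro sum.cong refl) (auto simp: abs_signed_pair)
  also have "\<dots> = (\<Sum>j<n. \<bar>B W i j\<bar>)"
    using i by (subst row_sum_eq_sum_cbm_pairs) (auto simp: cbm_signed_sym)
  finally show "D \<le> (\<Sum>(k,l)\<in>cbm_pairs n. if k = i \<or> l = i then \<bar>W (k, l)\<bar> else 0)" using W by simp
qed

text \<open>The double sum counts every edge twice, hence the halves in the exponent. A large tilt
  \<open>\<theta>\<close> allows a small edge density, at the price of the factor
  \<open>exp \<theta>\<close>, which is affordable on small sets only.\<close>

lemma prob_edges_within_ge:
  assumes A: "A \<subseteq> {..<n}" and \<theta>: "\<theta> \<ge> 0"
  shows "Pr {W. (\<Sum>i\<in>A. \<Sum>j\<in>A. \<bar>B W i j\<bar>) \<ge> t} \<le> exp (p * exp \<theta> * (real (card A))\<^sup>2 / 2 - \<theta> * t / 2)"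
proof (rule chernoff[where g = "\<lambda>k l w. if k \<in> A \<and> l \<in> A then \<theta> * \<bar>w\<bar> else 0"
      and c = "\<lambda>k l. if k \<in> A \<and> l \<in> A then p * (exp \<theta> - 1) else 0"])
  have within: "(\<Sum>i<n. \<Sum>j<n. if i \<in> A \<and> j \<in> A then F i j else 0) = (\<Sum>i\<in>A. \<Sum>j\<in>A. F i j)" for F :: "nat \<Rightarrow> nat \<Rightarrow> real"
  proof -
    have "(\<Sum>j<n. if i \<in> A \<and> j \<in> A then F i j else 0) = (if i \<in> A then \<Sum>j\<in>A. F i j else 0)" for i
      using A by (auto simp: sum.If_cases Int_absorb1)
    then show ?thesis using A by (simp add: sum.If_cases Int_absorb1)
  qed
  {
    fix k l assume kl: "(k, l) \<in> cbm_pairs n"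
    show "measure_pmf.expectation (cbm_entry_pmf p eps (\<sigma> k * \<sigma> l))
      (\<lambda>w. exp (if k \<in> A \<and> l \<in> A then \<theta> * \<bar>w\<bar> else 0)) \<le> exp (if k \<in> A \<and> l \<in> A then p * (exp \<theta> - 1) else 0)"
      using mgf_cbm_entry_abs[OF p eps sign_pair[OF kl], of \<theta>] by (cases "k \<in> A \<and> l \<in> A") auto
  next
    have "2 * (\<Sum>(k,l)\<in>cbm_pairs n. if k \<in> A \<and> l \<in> A then p * (exp \<theta> - 1) else 0)
       = 2 * (\<Sum>(k,l)\<in>cbm_pairs n. if k \<in> A \<and> l \<in> A then if k = l then 0 else p * (exp \<theta> - 1) else 0)"
      by (intro arg_cong[where f = "\<lambda>x. 2 * x"] sum.cong refl) (auto simp: cbm_pairs_def)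
    also have "\<dots> = (\<Sum>k<n. \<Sum>l<n. if k \<in> A \<and> l \<in> A then if k = l then 0 else p * (exp \<theta> - 1) else 0)"
      by (rule sum_symmetric_eq_sum_cbm_pairs[symmetric]) auto
    also have "\<dots> = (\<Sum>k\<in>A. \<Sum>l\<in>A. if k = l then 0 else p * (exp \<theta> - 1))"
      by (rule within)
    also have "\<dots> \<le> (\<Sum>k\<in>A. \<Sum>l\<in>A. p * exp \<theta>)"
      using p \<theta> by (intro sum_mono) (auto intro!: mult_left_mono)
    also have "\<dots> = p * exp \<theta> * (real (card A))\<^sup>2" by (simp add: power2_eq_square)
    finally show "(\<Sum>(k,l)\<in>cbm_pairs n. if k \<in> A \<and> l \<in> A then p * (exp \<theta> - 1) else 0) \<le> p * exp \<theta> * (real (card A))\<^sup>2 / 2"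
      by simp
  next
    fix W assume W: "W \<in> {W. (\<Sum>i\<in>A. \<Sum>j\<in>A. \<bar>B W i j\<bar>) \<ge> t}"
    have "2 * (\<Sum>(k,l)\<in>cbm_pairs n. if k \<in> A \<and> l \<in> A then \<theta> * \<bar>W (k, l)\<bar> else 0)
        = 2 * (\<Sum>(k,l)\<in>cbm_pairs n. if k \<in> A \<and> l \<in> A then \<theta> * \<bar>B W k l\<bar> else 0)"
      by (intro arg_cong[where f = "\<lambda>x. 2 * x"] sum.cong refl) (auto simp: abs_signed_pair)
    also have "\<dots> = (\<Sum>k<n. \<Sum>l<n. if k \<in> A \<and> l \<in> A then \<theta> * \<bar>B W k l\<bar> else 0)"
      by (rule sum_symmetric_eq_sum_cbm_pairs[symmetric]) (auto simp: cbm_signed_sym)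
    also have "\<dots> = (\<Sum>k\<in>A. \<Sum>l\<in>A. \<theta> * \<bar>B W k l\<bar>)" by (rule within)
    also have "\<dots> = \<theta> * (\<Sum>k\<in>A. \<Sum>l\<in>A. \<bar>B W k l\<bar>)" by (simp add: sum_distrib_left)
    also have "\<dots> \<ge> \<theta> * t" using W \<theta> by (simp add: mult_left_mono)
    finally show "\<theta> * t / 2 \<le> (\<Sum>(k,l)\<in>cbm_pairs n. if k \<in> A \<and> l \<in> A then \<theta> * \<bar>W (k, l)\<bar> else 0)" by simp
  }
qed

text \<open>Lightness together with \<open>l * \<kappa> \<le> 1\<close> keeps every exponent in the
  range of the centred estimate. The variance proxy is half of \<open>p * l^2\<close> times the
  squared norm of \<open>z\<close> to the power two, hence 8 = 16 / 2.\<close>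

lemma prob_light_form_ge:
  fixes z :: "nat \<Rightarrow> real"
  assumes z: "(\<Sum>i<n. (z i)\<^sup>2) \<le> 4 * n" and l: "l \<ge> 0" "l * \<kappa> \<le> 1"
  shows "Pr {W. (\<Sum>i<n. \<Sum>j<n. if i \<noteq> j \<and> \<bar>z i * z j\<bar> \<le> \<kappa> then (B W i j - p * (1 - 2 * eps)) * z i * z j else 0) \<ge> t}
    \<le> exp (8 * p * l\<^sup>2 * (real n)\<^sup>2 - l * t / 2)"
proof (rule chernoff[where g = "\<lambda>i j w. if i \<noteq> j \<and> \<bar>z i * z j\<bar> \<le> \<kappa> then l * (z i * z j) * (\<sigma> i * \<sigma> j * w - p * (1 - 2 * eps)) else 0"
      and c = "\<lambda>i j. p * (l * (z i * z j))\<^sup>2"])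
  fix i j assume ij: "(i, j) \<in> cbm_pairs n"
  show "measure_pmf.expectation (cbm_entry_pmf p eps (\<sigma> i * \<sigma> j))
      (\<lambda>w. exp (if i \<noteq> j \<and> \<bar>z i * z j\<bar> \<le> \<kappa> then l * (z i * z j) * (\<sigma> i * \<sigma> j * w - p * (1 - 2 * eps)) else 0))
      \<le> exp (p * (l * (z i * z j))\<^sup>2)"
  proof (cases "i \<noteq> j \<and> \<bar>z i * z j\<bar> \<le> \<kappa>")
    case True
    have "\<bar>l * (z i * z j)\<bar> = l * \<bar>z i * z j\<bar>" using l by (simp add: abs_mult)
    also have "\<dots> \<le> l * \<kappa>" using l True by (intro mult_left_mono) auto
    finally show ?thesis
      using mgf_cbm_entry_centred[OF p eps sign_pair[OF ij], of "l * (z i * z j)"] l True by simp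
  next
    case False
    then show ?thesis using p by auto
  qed
next
  have "2 * (\<Sum>(i,j)\<in>cbm_pairs n. p * (l * (z i * z j))\<^sup>2)
      = 2 * (\<Sum>(i,j)\<in>cbm_pairs n. if i = j then 0 else p * (l * (z i * z j))\<^sup>2)"
    by (intro arg_cong[where f = "\<lambda>x. 2 * x"] sum.cong refl) (auto simp: cbm_pairs_def)
  also have "\<dots> = (\<Sum>i<n. \<Sum>j<n. if i = j then 0 else p * (l * (z i * z j))\<^sup>2)"
    by (rule sum_symmetric_eq_sum_cbm_pairs[symmetric]) (auto simp: mult.commute)
  also have "\<dots> \<le> (\<Sum>i<n. \<Sum>j<n. p * l\<^sup>2 * ((z i)\<^sup>2 * (z j)\<^sup>2))"
    using p by (intro sum_mono) (auto simp: power_mult_distrib)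
  also have "\<dots> = p * l\<^sup>2 * ((\<Sum>i<n. (z i)\<^sup>2) * (\<Sum>i<n. (z i)\<^sup>2))"
    unfolding sum_product by (simp add: sum_distrib_left)
  also have "\<dots> \<le> p * l\<^sup>2 * ((4 * real n) * (4 * real n))"
  proof (intro mult_left_mono)
    show "(\<Sum>i<n. (z i)\<^sup>2) * (\<Sum>i<n. (z i)\<^sup>2) \<le> 4 * real n * (4 * real n)"
      using z by (intro mult_mono) (auto intro: sum_nonneg)
  qed (use p in auto)
  finally show "(\<Sum>(i,j)\<in>cbm_pairs n. p * (l * (z i * z j))\<^sup>2) \<le> 8 * p * l\<^sup>2 * (real n)\<^sup>2"
    by (simp add: power2_eq_square mult_ac)
next
  let ?F = "\<lambda>W i j. if i \<noteq> j \<and> \<bar>z i * z j\<bar> \<le> \<kappa> then (B W i j - p * (1 - 2 * eps)) * z i * z j else 0"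
  fix W assume W: "W \<in> {W. (\<Sum>i<n. \<Sum>j<n. ?F W i j) \<ge> t}"
  have "(\<Sum>(i,j)\<in>cbm_pairs n. if i \<noteq> j \<and> \<bar>z i * z j\<bar> \<le> \<kappa> then l * (z i * z j) * (\<sigma> i * \<sigma> j * W (i, j) - p * (1 - 2 * eps)) else 0)
    = (\<Sum>(i,j)\<in>cbm_pairs n. l * ?F W i j)"
    by (intro sum.cong refl) (auto simp: cbm_signed_pair)
  also have "\<dots> = l * (\<Sum>(i,j)\<in>cbm_pairs n. ?F W i j)" by (simp add: sum_distrib_left case_prod_beta)
  also have "(\<Sum>(i,j)\<in>cbm_pairs n. ?F W i j) = (\<Sum>i<n. \<Sum>j<n. ?F W i j) / 2"
    by (subst sum_symmetric_eq_sum_cbm_pairs) (auto simp: cbm_signed_sym mult_ac)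
  also have "l * (t / 2) \<le> l * ((\<Sum>i<n. \<Sum>j<n. ?F W i j) / 2)" using W l by (intro mult_left_mono) auto
  finally show "l * t / 2 \<le> (\<Sum>(i,j)\<in>cbm_pairs n. if i \<noteq> j \<and> \<bar>z i * z j\<bar> \<le> \<kappa> then l * (z i * z j) * (\<sigma> i * \<sigma> j * W (i, j) - p * (1 - 2 * eps)) else 0)" by simp
qed

end

subsection \<open>Union bounds\<close>

lemma sum_half_power_abs: "(\<Sum>z\<in>{-int m..int m}. (1/2::real) ^ nat \<bar>z\<bar>) = 3 - 2 * (1/2) ^ m"
proof (induction m)
  case 0
  then show ?case by simp
next
  case (Suc m)
  have "{-int (Suc m)..int (Suc m)} = insert (int (Suc m)) (insert (- int (Suc m)) {-int m..int m})"
    by auto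
  then have "(\<Sum>z\<in>{-int (Suc m)..int (Suc m)}. (1/2::real) ^ nat \<bar>z\<bar>)
      = (1/2) ^ nat \<bar>int (Suc m)\<bar> + ((1/2) ^ nat \<bar>- int (Suc m)\<bar> + (\<Sum>z\<in>{-int m..int m}. (1/2::real) ^ nat \<bar>z\<bar>))"
    by (simp only:) (subst sum.insert; simp)+
  also have "\<dots> = (1/2) ^ Suc m + ((1/2) ^ Suc m + (3 - 2 * (1/2) ^ m))"
    unfolding Suc by (simp only: abs_minus_cancel abs_of_nat nat_int)
  finally show ?case by simp
qed

text \<open>Give \<open>z\<close> the product weight with factors
  \<open>(1/2) ^ nat \<bar>z i\<bar>\<close>. As absolute values of integers are at most their
  squares, each vector of \<open>Z\<close> has weight at least \<open>(1/2) ^ (4 * n)\<close>, while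
  all weights together are at most \<open>3 ^ n\<close>. This gives \<open>48 ^ n\<close> vectors at
  most.\<close>

lemma card_integer_vectors_le:
  fixes n :: nat
  defines "Z \<equiv> {z \<in> {..<n} \<rightarrow>\<^sub>E (UNIV :: int set). (\<Sum>i<n. (z i)\<^sup>2) \<le> 4 * int n}"
  shows "finite Z" "card Z \<le> exp (6 * real n)"
proof -
  define m where "m = 4 * n"
  define R where "R = {..<n} \<rightarrow>\<^sub>E {-int m..int m}"
  have fin: "finite R" unfolding R_def by (intro finite_PiE) auto
  have abs_le: "\<bar>x\<bar> \<le> x\<^sup>2" for x :: int
  proof (cases "x = 0")
    case False
    then have "\<bar>x\<bar> * 1 \<le> \<bar>x\<bar> * \<bar>x\<bar>" by (intro mult_left_mono) auto
    then show ?thesis by (simp add: power2_eq_square)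
  qed simp
  have sub: "Z \<subseteq> R"
  proof
    fix z assume z: "z \<in> Z"
    have "\<bar>z i\<bar> \<le> int m" if "i < n" for i
    proof -
      have "\<bar>z i\<bar> \<le> (z i)\<^sup>2" by (rule abs_le)
      also have "\<dots> \<le> (\<Sum>i<n. (z i)\<^sup>2)" using that by (intro member_le_sum) auto
      finally show ?thesis using z by (simp add: Z_def m_def)
    qed
    then show "z \<in> R" using z by (force simp: R_def Z_def PiE_iff abs_le_iff)
  qed
  then show "finite Z" using fin by (rule finite_subset)
  have "real (card Z) = (\<Sum>z\<in>Z. 1)" by simp
  also have "\<dots> \<le> (\<Sum>z\<in>Z. 2 ^ m * (\<Prod>i<n. (1/2) ^ nat \<bar>z i\<bar>))"
  proof (rule sum_mono)
    fix z assume z: "z \<in> Z"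
    have "int (\<Sum>i<n. nat \<bar>z i\<bar>) = (\<Sum>i<n. \<bar>z i\<bar>)" by simp
    also have "\<dots> \<le> (\<Sum>i<n. (z i)\<^sup>2)" by (intro sum_mono abs_le)
    also have "\<dots> \<le> int m" using z by (simp add: Z_def m_def)
    finally have le: "(\<Sum>i<n. nat \<bar>z i\<bar>) \<le> m" by linarith
    have "(1::real) = 2 ^ m * (1/2) ^ m" by (simp flip: power_mult_distrib)
    also have "\<dots> \<le> 2 ^ m * (1/2) ^ (\<Sum>i<n. nat \<bar>z i\<bar>)"
      using le by (intro mult_left_mono power_decreasing) auto
    finally show "1 \<le> 2 ^ m * (\<Prod>i<n. (1/2::real) ^ nat \<bar>z i\<bar>)" by (simp add: power_sum)
  qed
  also have "\<dots> \<le> (\<Sum>z\<in>R. 2 ^ m * (\<Prod>i<n. (1/2) ^ nat \<bar>z i\<bar>))"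
    using fin sub by (intro sum_mono2 mult_nonneg_nonneg prod_nonneg) auto
  also have "\<dots> = 2 ^ m * (\<Prod>i<n. \<Sum>z\<in>{-int m..int m}. (1/2) ^ nat \<bar>z\<bar>)"
    unfolding R_def by (subst prod_sum_PiE) (auto simp: sum_distrib_left)
  also have "\<dots> = 2 ^ m * (3 - 2 * (1/2) ^ m) ^ n" by (simp add: sum_half_power_abs)
  also have "\<dots> \<le> 2 ^ m * 3 ^ n"
    using power_le_one[of "1/2::real" m] by (intro mult_left_mono power_mono) auto
  also have "\<dots> = 48 ^ n" by (simp add: m_def power_mult flip: power_mult_distrib)
  also have "\<dots> \<le> (exp 6) ^ n"
  proof (rule power_mono)
    \<comment> \<open>48 is below 64, which is at most \<open>exp 6\<close>.\<close>
    have "(2::real) ^ 6 \<le> exp 1 ^ 6" using exp_ge_add_one_self[of 1] by (intro power_mono) auto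
    then show "(48::real) \<le> exp 6" by (simp flip: exp_of_nat_mult)
  qed simp
  also have "\<dots> = exp (6 * real n)" by (simp add: mult.commute flip: exp_of_nat_mult)
  finally show "card Z \<le> exp (6 * real n)" .
qed

lemma prob_pmf_ex_le:
  assumes "finite I" "\<And>i. i \<in> I \<Longrightarrow> measure_pmf.prob M {W. Q i W} \<le> b i"
  shows "measure_pmf.prob M {W. \<exists>i\<in>I. Q i W} \<le> (\<Sum>i\<in>I. b i)"
proof -
  have "{W. \<exists>i\<in>I. Q i W} = (\<Union>i\<in>I. {W. Q i W})" by auto
  then have "measure_pmf.prob M {W. \<exists>i\<in>I. Q i W} \<le> (\<Sum>i\<in>I. measure_pmf.prob M {W. Q i W})"
    using assms(1) by (simp add: measure_UNION_le)
  also have "\<dots> \<le> (\<Sum>i\<in>I. b i)" by (rule sum_mono) (rule assms(2))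
  finally show ?thesis .
qed

section \<open>Failure probabilities of sparsity and of the light form\<close>

context cbm
begin

text \<open>The size restriction bounds the moment term by \<open>L * card A\<close>, and
  \<open>\<theta> * \<beta> = 6\<close> makes the deviation term \<open>3 * L * card A\<close>. A
  fixed \<open>A\<close> thus fails with probability at most \<open>x ^ card A\<close> for
  \<open>x = 1 / n^2\<close>, and summing over all nonempty sets gives
  \<open>(1 + x) ^ n - 1\<close>.\<close>

lemma prob_ex_dense_set_le:
  fixes a L r \<theta> \<beta> :: real
  assumes n: "n > 0" and \<theta>: "\<theta> \<ge> 0" "\<theta> * \<beta> = 6"
    and pL: "p * n = a * L" and L: "L = ln n" and r: "r > 0" "2 * a * exp \<theta> \<le> r"
  shows "Pr {W. \<exists>A\<in>{A. A \<subseteq> {..<n} \<and> A \<noteq> {} \<and> r * card A \<le> 4 * n}.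
    (\<Sum>i\<in>A. \<Sum>j\<in>A. \<bar>B W i j\<bar>) \<ge> \<beta> * L * card A} \<le> 2 / n"
proof -
  define I where "I = {A. A \<subseteq> {..<n} \<and> A \<noteq> {} \<and> r * card A \<le> 4 * n}"
  have I: "I \<subseteq> Pow {..<n} - {{}}" "finite I"
    by (auto simp: I_def intro: finite_subset[of _ "Pow {..<n}"])
  have L0: "L \<ge> 0" using n L by simp
  define x where "x = exp (- 2 * L)"
  have x: "x = 1 / (real n)\<^sup>2"
  proof -
    have "exp (2 * L) = (real n)\<^sup>2"
      using n L by (simp add: exp_double)
    then show ?thesis by (simp add: x_def exp_minus divide_inverse)
  qed
  have "Pr {W. (\<Sum>i\<in>A. \<Sum>j\<in>A. \<bar>B W i j\<bar>) \<ge> \<beta> * L * card A} \<le> x ^ card A" if "A \<in> I" for A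
  proof -
    have "Pr {W. (\<Sum>i\<in>A. \<Sum>j\<in>A. \<bar>B W i j\<bar>) \<ge> \<beta> * L * card A}
        \<le> exp (p * exp \<theta> * (real (card A))\<^sup>2 / 2 - \<theta> * (\<beta> * L * card A) / 2)"
      using that \<theta> by (intro prob_edges_within_ge) (auto simp: I_def)
    also have "p * exp \<theta> * (real (card A))\<^sup>2 / 2 - \<theta> * (\<beta> * L * card A) / 2 \<le> card A * (- 2 * L)"
    proof -
      \<comment> \<open>Multiplied by \<open>r * n\<close> so that the size restriction can replace
        \<open>r * card A\<close> by \<open>4 * n\<close>.\<close>
      have "p * exp \<theta> * (real (card A))\<^sup>2 / 2 * (r * n) = (p * n) * exp \<theta> * card A / 2 * (r * card A)"
        by (simp add: power2_eq_square)
      also have "\<dots> \<le> (p * n) * exp \<theta> * card A / 2 * (4 * n)"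
        using that p by (intro mult_left_mono) (auto simp: I_def)
      also have "\<dots> = (2 * a * exp \<theta>) * (L * card A * n)" by (simp add: pL)
      also have "\<dots> \<le> r * (L * card A * n)" using L0 r by (intro mult_right_mono) auto
      also have "\<dots> = L * card A * (r * n)" by simp
      finally have "p * exp \<theta> * (real (card A))\<^sup>2 / 2 \<le> L * card A"
        using r n by (subst (asm) mult_le_cancel_right_pos) auto
      moreover have "\<theta> * (\<beta> * L * card A) = 6 * (L * card A)" using \<theta>(2) by (simp flip: mult.assoc)
      moreover have "card A * (- 2 * L) = - 2 * (L * card A)" by simp
      ultimately show ?thesis by linarith
    qed
    finally show ?thesis by (simp only: x_def exp_le_cancel_iff flip: exp_of_nat_mult)
  qed
  then have "Pr {W. \<exists>A\<in>I. (\<Sum>i\<in>A. \<Sum>j\<in>A. \<bar>B W i j\<bar>) \<ge> \<beta> * L * card A} \<le> (\<Sum>A\<in>I. x ^ card A)"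
    using I(2) by (intro prob_pmf_ex_le)
  also have "\<dots> \<le> (\<Sum>A\<in>Pow {..<n} - {{}}. x ^ card A)"
    using I by (intro sum_mono2) (auto simp: x_def)
  also have "\<dots> = (\<Sum>A\<in>Pow {..<n}. x ^ card A) - 1"
    by (subst sum_diff1) auto
  also have "(\<Sum>A\<in>Pow {..<n}. x ^ card A) = (1 + x) ^ n"
    using prod_add[of "{..<n}" "\<lambda>_. x" "\<lambda>_. 1"] by (simp add: add.commute)
  also have "(1 + x) ^ n \<le> exp x ^ n" 
    by (intro power_mono exp_ge_add_one_self) (simp add: x_def)
  also have "exp x ^ n = exp (1 / n)" using n by (simp add: x power2_eq_square flip: exp_of_nat_mult)
  also have "exp (1 / n) \<le> 1 + 1 / n + (1 / n)\<^sup>2" using n by (intro exp_bound) auto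
  also have "1 + 1 / n + (1 / n)\<^sup>2 \<le> 1 + 2 / real n"
    using n by (simp add: power2_eq_square field_simps)
  finally show ?thesis by (simp add: I_def)
qed

text \<open>A single vector fails with probability at most \<open>exp (- 7 * n)\<close>, which beats
  the at most \<open>exp (6 * n)\<close> integer vectors.\<close>

lemma prob_ex_light_form_le:
  fixes a L \<delta> \<kappa> :: real
  assumes pL: "p * n = a * L" and pos: "L > 0" "\<delta> > 0"
    and large: "16 * \<kappa> \<le> \<delta> * L" "2048 * a \<le> \<delta>\<^sup>2 * L"
  shows "Pr {W. \<exists>z :: nat \<Rightarrow> int. (\<Sum>i<n. (z i)\<^sup>2) \<le> 4 * int n \<and>
    (\<Sum>i<n. \<Sum>j<n. if i \<noteq> j \<and> \<bar>real_of_int (z i) * z j\<bar> \<le> \<kappa> then (B W i j - p * (1 - 2 * eps)) * z i * z j else 0) \<ge> \<delta> * L * n}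
    \<le> exp (- real n)"
proof -
  define F where "F W z = (\<Sum>i<n. \<Sum>j<n. if i \<noteq> j \<and> \<bar>real_of_int (z i) * z j\<bar> \<le> \<kappa> then (B W i j - p * (1 - 2 * eps)) * z i * z j else 0)"
    for W and z :: "nat \<Rightarrow> int"
  define Z where "Z = {z \<in> {..<n} \<rightarrow>\<^sub>E (UNIV :: int set). (\<Sum>i<n. (z i)\<^sup>2) \<le> 4 * int n}"
  \<comment> \<open>With this tilt the deviation term is exactly \<open>8 * n\<close>; the first
    condition of \<open>large\<close> gives \<open>l * \<kappa> \<le> 1\<close> and the second
    bounds the variance term by \<open>n\<close>.\<close>
  define l where "l = 16 / (\<delta> * L)"
  have l: "l \<ge> 0" "l * \<kappa> \<le> 1" using pos large by (auto simp: l_def field_simps)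
  have "Pr {W. F W z \<ge> \<delta> * L * n} \<le> exp (- 7 * real n)" if "z \<in> Z" for z
  proof -
    have "real_of_int (\<Sum>i<n. (z i)\<^sup>2) \<le> real_of_int (4 * int n)"
      using that unfolding Z_def by (subst of_int_le_iff) auto
    then have "(\<Sum>i<n. (real_of_int (z i))\<^sup>2) \<le> 4 * n" by simp
    then have "Pr {W. F W z \<ge> \<delta> * L * n} \<le> exp (8 * p * l\<^sup>2 * (real n)\<^sup>2 - l * (\<delta> * L * n) / 2)"
      unfolding F_def by (rule prob_light_form_ge[OF _ l])
    also have "8 * p * l\<^sup>2 * (real n)\<^sup>2 - l * (\<delta> * L * n) / 2 \<le> - 7 * real n"
    proof -
      have "8 * p * l\<^sup>2 * (real n)\<^sup>2 = 8 * l\<^sup>2 * n * (p * n)" by (simp add: power2_eq_square)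
      also have "\<dots> = (2048 * a) / (\<delta>\<^sup>2 * L) * n"
        unfolding pL using pos by (simp add: l_def power2_eq_square field_simps)
      also have "\<dots> \<le> 1 * real n" using large pos by (intro mult_right_mono) (auto simp: field_simps)
      finally show ?thesis using pos by (simp add: l_def)
    qed
    finally show ?thesis by simp
  qed
  then have "Pr {W. \<exists>z\<in>Z. F W z \<ge> \<delta> * L * n} \<le> (\<Sum>z\<in>Z. exp (- 7 * real n))"
    using card_integer_vectors_le(1)[of n] by (intro prob_pmf_ex_le) (auto simp: Z_def)
  also have "\<dots> = card Z * exp (- 7 * real n)" by simp
  also have "\<dots> \<le> exp (6 * real n) * exp (- 7 * real n)"
    using card_integer_vectors_le(2)[of n] by (intro mult_right_mono) (auto simp: Z_def)
  also have "\<dots> = exp (- real n)" by (simp flip: exp_add)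
  finally have *: "Pr {W. \<exists>z\<in>Z. F W z \<ge> \<delta> * L * n} \<le> exp (- real n)" .
  \<comment> \<open>Only values below \<open>n\<close> matter, so \<open>z\<close> may be restricted
    to become a member of the finite set \<open>Z\<close>.\<close>
  have "(\<exists>z. (\<Sum>i<n. (z i)\<^sup>2) \<le> 4 * int n \<and> F W z \<ge> \<delta> * L * n) \<longrightarrow> (\<exists>z\<in>Z. F W z \<ge> \<delta> * L * n)" for W
  proof
    assume "\<exists>z. (\<Sum>i<n. (z i)\<^sup>2) \<le> 4 * int n \<and> F W z \<ge> \<delta> * L * n"
    then obtain z where z: "(\<Sum>i<n. (z i)\<^sup>2) \<le> 4 * int n" "F W z \<ge> \<delta> * L * n" by blast
    have "F W (restrict z {..<n}) = F W z"
      unfolding F_def by (intro sum.cong refl) simp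
    then show "\<exists>z\<in>Z. F W z \<ge> \<delta> * L * n"
      using z by (intro bexI[of _ "restrict z {..<n}"]) (auto simp: Z_def)
  qed
  then have "Pr {W. \<exists>z. (\<Sum>i<n. (z i)\<^sup>2) \<le> 4 * int n \<and> F W z \<ge> \<delta> * L * n} \<le> Pr {W. \<exists>z\<in>Z. F W z \<ge> \<delta> * L * n}"
    by (intro measure_pmf.finite_measure_mono) auto
  with * show ?thesis unfolding F_def by linarith
qed

text \<open>
  The four error terms come from, in this order, the row sums, the degrees, the sparsity of small
  vertex sets and the light part of the quadratic form.
\<close>

lemma prob_sdp_unique_opt_ge:
  fixes a x D K \<delta> \<eta> \<beta> \<kappa> \<theta> :: real
  defines "L \<equiv> ln (real n)"
  assumes n: "n > 1" and eps_half: "eps \<le> 1/2" and pL: "p * n = a * L"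
    and pos: "x \<ge> 0" "K \<ge> 0" "\<delta> > 0" "\<eta> > 0" "\<beta> > 0" "\<kappa> > 0" "\<theta> \<ge> 0"
    and D: "\<delta> + 8 * \<eta> * K + 4 * \<beta> / \<eta> + 16 * a / \<kappa> \<le> D"
    and \<theta>: "\<theta> * \<beta> = 6" "2 * a * exp \<theta> \<le> \<eta> * \<kappa>"
    and large: "16 * \<kappa> \<le> \<delta> * L" "2048 * a \<le> \<delta>\<^sup>2 * L"
  shows "Pr {W. sdp_unique_opt n (cbm_adj W) (\<lambda>i j. \<sigma> i * \<sigma> j)} \<ge> 1 -
    (n * exp (x * (D * L) - p * (real n - 1) * (1 - (1 - eps) * exp (- x) - eps * exp x)) +
     n * exp (2 * p * n - K * L) + 2 / n + exp (- real n))"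
proof -
  have L: "L > 0" using n by (simp add: L_def)
  \<comment> \<open>The mean of a signed entry; \<open>eps \<le> 1/2\<close> makes it
    nonnegative.\<close>
  define q where "q = p * (1 - 2 * eps)"
  have q: "q \<ge> 0" "q * n \<le> a * L"
  proof -
    show "q \<ge> 0" using p eps_half by (simp add: q_def)
    have "q \<le> p * 1" unfolding q_def using p eps by (intro mult_left_mono) auto
    then have "q * n \<le> p * n" by (intro mult_right_mono) auto
    then show "q * n \<le> a * L" using pL by simp
  qed
  define S1 where "S1 = {W. \<exists>i\<in>{..<n}. (\<Sum>j<n. B W i j) \<le> D * L}"
  define S2 where "S2 = {W. \<exists>i\<in>{..<n}. (\<Sum>j<n. \<bar>B W i j\<bar>) \<ge> K * L}"
  \<comment> \<open>The empty set is excluded because 0 \<ge> 0 would make the event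
    certain.\<close>
  define S3 where "S3 = {W. \<exists>A\<in>{A. A \<subseteq> {..<n} \<and> A \<noteq> {} \<and> \<eta> * \<kappa> * card A \<le> 4 * n}.
    (\<Sum>i\<in>A. \<Sum>j\<in>A. \<bar>B W i j\<bar>) \<ge> \<beta> * L * card A}"
  define S4 where "S4 = {W. \<exists>z :: nat \<Rightarrow> int. (\<Sum>i<n. (z i)\<^sup>2) \<le> 4 * int n \<and>
    (\<Sum>i<n. \<Sum>j<n. if i \<noteq> j \<and> \<bar>real_of_int (z i) * z j\<bar> \<le> \<kappa> then (B W i j - q) * z i * z j else 0) \<ge> \<delta> * L * n}"
  define G where "G = {W. sdp_unique_opt n (cbm_adj W) (\<lambda>i j. \<sigma> i * \<sigma> j)}"
  have "W \<in> G" if "W \<notin> S1 \<union> S2 \<union> S3 \<union> S4" for W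
  proof -
    from that have W1: "\<And>i. i < n \<Longrightarrow> (\<Sum>j<n. B W i j) > D * L"
      and W2: "\<And>i. i < n \<Longrightarrow> (\<Sum>j<n. \<bar>B W i j\<bar>) \<le> K * L"
      by (auto simp: S1_def S2_def not_le not_less intro: less_imp_le)
    have W3: "(\<Sum>i\<in>A. \<Sum>j\<in>A. \<bar>B W i j\<bar>) \<le> \<beta> * L * card A" if "A \<subseteq> {..<n}" "\<eta> * \<kappa> * card A \<le> 4 * n" for A
      using \<open>W \<notin> S1 \<union> S2 \<union> S3 \<union> S4\<close> that by (cases "A = {}") (auto simp: S3_def not_le intro: less_imp_le)
    have W4: "(\<Sum>i<n. \<Sum>j<n. if i \<noteq> j \<and> \<bar>real_of_int (z i) * z j\<bar> \<le> \<kappa> then (B W i j - q) * z i * z j else 0) \<le> \<delta> * L * n"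
      if "(\<Sum>i<n. (z i)\<^sup>2) \<le> 4 * int n" for z :: "nat \<Rightarrow> int"
      using \<open>W \<notin> S1 \<union> S2 \<union> S3 \<union> S4\<close> that unfolding S4_def by (force simp: not_le)
    have sum_le: "\<delta> * L + 8 * \<eta> * (K * L) + 4 * (\<beta> * L) / \<eta> + 16 * q * n / \<kappa> \<le> D * L"
    proof -
      have "16 * q * n / \<kappa> \<le> 16 * (a * L) / \<kappa>" using q pos by (intro divide_right_mono) auto
      then have "\<delta> * L + 8 * \<eta> * (K * L) + 4 * (\<beta> * L) / \<eta> + 16 * q * n / \<kappa>
          \<le> (\<delta> + 8 * \<eta> * K + 4 * \<beta> / \<eta> + 16 * a / \<kappa>) * L"
        by (simp add: algebra_simps)
      also have "\<dots> \<le> D * L" using D L by (intro mult_right_mono) auto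
      finally show ?thesis .
    qed
    have "sdp_unique_opt n (cbm_adj W) (\<lambda>i j. \<sigma> i * \<sigma> j)"
    proof (rule sdp_unique_optI)
      fix u :: "nat \<Rightarrow> real"
      assume u: "(\<Sum>i<n. u i) = 0" "\<exists>i<n. u i \<noteq> 0"
      have "(\<Sum>i<n. \<Sum>j<n. B W i j * u i * u j) < (\<Sum>i<n. (\<Sum>j<n. B W i j) * (u i)\<^sup>2)"
        by (rule certificate_of_regularity[where q = q and \<delta> = "\<delta> * L" and \<eta> = \<eta> and \<kappa> = \<kappa> and \<beta> = "\<beta> * L" and K = "K * L" and D = "D * L"])
           (use W1 W2 W3 W4 sum_le u pos L q cbm_signed_sym in auto)
      then show "(\<Sum>i<n. \<Sum>j<n. \<sigma> i * \<sigma> j * cbm_adj W i j * u i * u j)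
          < (\<Sum>i<n. (\<Sum>j<n. \<sigma> i * \<sigma> j * cbm_adj W i j) * (u i)\<^sup>2)"
        by (simp add: cbm_signed_def)
    qed (use \<sigma> in \<open>auto simp: cbm_adj_def\<close>)
    then show ?thesis by (simp add: G_def)
  qed
  then have "- G \<subseteq> S1 \<union> S2 \<union> S3 \<union> S4" by blast
  then have "Pr (- G) \<le> Pr (S1 \<union> S2 \<union> S3 \<union> S4)"
    by (intro measure_pmf.finite_measure_mono) auto
  also have "\<dots> \<le> Pr S1 + Pr S2 + Pr S3 + Pr S4"
    by (intro order_trans[OF measure_Un_le] add_mono) auto
  also have "Pr S1 \<le> (\<Sum>i<n. exp (x * (D * L) - p * (real n - 1) * (1 - (1 - eps) * exp (- x) - eps * exp x)))"
    unfolding S1_def using pos by (intro prob_pmf_ex_le prob_row_sum_le) auto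
  also have "Pr S2 \<le> (\<Sum>i<n. exp (2 * p * n - K * L))"
    unfolding S2_def by (intro prob_pmf_ex_le prob_degree_ge) auto
  also have "Pr S3 \<le> 2 / n"
    unfolding S3_def using n pos \<theta> pL by (intro prob_ex_dense_set_le[where a = a]) (auto simp: L_def)
  also have "Pr S4 \<le> exp (- real n)"
    unfolding S4_def q_def using L pos large pL by (intro prob_ex_light_form_le[where a = a]) auto
  also have "Pr (- G) = 1 - Pr G"
    using measure_pmf.prob_compl[of G] by (simp add: Compl_eq_Diff_UNIV)
  finally show ?thesis by (simp add: G_def)
qed

end

text \<open>For positive \<epsilon> the optimal tilt is \<open>ln (s / t)\<close> with
  \<open>s = sqrt (1 - \<epsilon>)\<close> and \<open>t = sqrt \<epsilon>\<close>, where the bracket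
  equals \<open>(s - t)^2\<close>. For \<open>\<epsilon> = 0\<close> the supremum is approached only
  as \<open>x\<close> tends to infinity, so a large finite tilt is taken.\<close>

lemma chernoff_exponent:
  fixes a \<epsilon> :: real
  assumes "a > 0" "0 \<le> \<epsilon>" "\<epsilon> \<le> 1/2" "a * (sqrt (1 - \<epsilon>) - sqrt \<epsilon>)^2 > 1"
  obtains x where "x > 0" "a * (1 - (1 - \<epsilon>) * exp (- x) - \<epsilon> * exp x) > 1"
proof (cases "\<epsilon> = 0")
  case True
  then have a: "a > 1" using assms by simp
  show ?thesis
  proof
    \<comment> \<open>This tilt gives the value \<open>(a + 1) / 2\<close>, halfway between 1 and
      the supremum \<open>a\<close>.\<close>
    show "ln (2 * a / (a - 1)) > 0" using a by (simp add: field_simps)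
    have "exp (- ln (2 * a / (a - 1))) = (a - 1) / (2 * a)"
      using a by (simp add: exp_minus)
    then show "a * (1 - (1 - \<epsilon>) * exp (- ln (2 * a / (a - 1))) - \<epsilon> * exp (ln (2 * a / (a - 1)))) > 1"
      using a True by (simp add: field_simps)
  qed
next
  case False
  define s t where "s = sqrt (1 - \<epsilon>)" and "t = sqrt \<epsilon>"
  have st: "s > 0" "t > 0" "s\<^sup>2 = 1 - \<epsilon>" "t\<^sup>2 = \<epsilon>" "t \<le> s"
    using False assms by (auto simp: s_def t_def)
  have "s \<noteq> t"
  proof
    assume "s = t"
    then show False using assms(4) unfolding s_def[symmetric] t_def[symmetric] by simp
  qed
  with st(5) have ts: "t < s" by simp
  show ?thesis
  proof
    show "ln (s / t) > 0" using st ts by simp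
    have "(1 - \<epsilon>) * exp (- ln (s / t)) + \<epsilon> * exp (ln (s / t)) = 2 * s * t"
    proof -
      have "(1 - \<epsilon>) * exp (- ln (s / t)) = s\<^sup>2 * (t / s)" using st(1-3) by (simp add: exp_minus)
      moreover have "\<epsilon> * exp (ln (s / t)) = t\<^sup>2 * (s / t)" using st(1,2,4) by simp
      ultimately show ?thesis using st(1,2) by (simp add: power2_eq_square)
    qed
    moreover have "1 - 2 * s * t = (s - t)\<^sup>2"
      using st(3,4) by (simp add: power2_eq_square algebra_simps)
    ultimately have "1 - (1 - \<epsilon>) * exp (- ln (s / t)) - \<epsilon> * exp (ln (s / t)) = (s - t)\<^sup>2" by linarith
    then show "a * (1 - (1 - \<epsilon>) * exp (- ln (s / t)) - \<epsilon> * exp (ln (s / t))) > 1"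
      using assms(4) by (simp add: s_def t_def)
  qed
qed

section \<open>Choice of the constants\<close>

theorem theorem6:
  fixes a \<epsilon> :: real
  assumes "a > 0" and "0 \<le> \<epsilon>" and "\<epsilon> \<le> 1/2"
    and "a * (sqrt (1 - \<epsilon>) - sqrt \<epsilon>)^2 > 1"
  shows "\<exists>c > 0. \<exists>N. \<forall>n \<ge> N. \<forall>\<sigma> :: nat \<Rightarrow> real. (\<forall>i<n. \<sigma> i \<in> {-1, 1}) \<longrightarrow>
           measure_pmf.prob (cbm_pmf n (a * ln (real n) / real n) \<epsilon> \<sigma>)
             {W. sdp_unique_opt n (cbm_adj W) (\<lambda>i j. \<sigma> i * \<sigma> j)}
           \<ge> 1 - real n powr (- c)"
proof -
  obtain x where x: "x > 0" "a * (1 - (1 - \<epsilon>) * exp (- x) - \<epsilon> * exp x) > 1"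
    using chernoff_exponent[OF assms] .
  define \<phi> where "\<phi> = 1 - (1 - \<epsilon>) * exp (- x) - \<epsilon> * exp x"
  \<comment> \<open>A quarter of the margin in the exponent: one \<nu> pays for the row threshold
    (\<open>x * D = \<nu>\<close>), one for \<open>n - 1\<close> in place of \<open>n\<close>, and
    two remain for the rate.\<close>
  define \<nu> where "\<nu> = (a * \<phi> - 1) / 4"
  have \<nu>: "\<nu> > 0" "a * \<phi> = 1 + 4 * \<nu>" using x(2) unfolding \<phi>_def[symmetric] by (simp_all add: \<nu>_def field_simps)
  define D where "D = \<nu> / x"
  \<comment> \<open>Chosen so that the union bound over degrees gives exactly
    \<open>1 / n\<close>.\<close>
  define K where "K = 2 * a + 2"
  \<comment> \<open>Each of the four contributions to the bound \<open>D\<close> receives at most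
    \<open>D / 4\<close>. The constants are fixed in the order \<delta>, \<eta>, \<beta>, \<theta>,
    \<kappa>; the second entry of the maximum in \<kappa> makes the relevant vertex sets small
    enough for the tilt \<theta>.\<close>
  define \<delta> where "\<delta> = D / 4"
  define \<eta> where "\<eta> = D / (32 * K)"
  define \<beta> where "\<beta> = \<eta> * D / 16"
  define \<theta> where "\<theta> = 6 / \<beta>"
  define \<kappa> where "\<kappa> = max (64 * a / D) (2 * a * exp \<theta> / \<eta>)"
  \<comment> \<open>With \<open>c \<le> 1/2\<close>, errors of order \<open>1 / n\<close> are below
    \<open>n powr (- 2 * c)\<close>; the spare factor \<open>n powr c\<close> later absorbs
    constants.\<close>
  define c where "c = min \<nu> (1/2)"
  have D: "D > 0" using \<nu> x by (simp add: D_def)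
  have K: "K > 0" using assms by (simp add: K_def)
  have \<eta>: "\<eta> > 0" using D K by (simp add: \<eta>_def)
  have \<beta>: "\<beta> > 0" using D \<eta> by (simp add: \<beta>_def)
  have \<kappa>: "\<kappa> \<ge> 64 * a / D" "\<kappa> \<ge> 2 * a * exp \<theta> / \<eta>" by (auto simp: \<kappa>_def)
  have "64 * a / D > 0" using assms D by simp
  then have \<kappa>0: "\<kappa> > 0" using \<kappa>(1) by linarith
  have c: "c > 0" "c \<le> \<nu>" "c \<le> 1/2" using \<nu> by (auto simp: c_def)
  \<comment> \<open>Lower bounds needed for \<open>ln n\<close>: the middle entries are the two
    conditions \<open>large\<close>, then the one for replacing \<open>n - 1\<close> by
    \<open>n\<close>, and last the one giving \<open>n powr c \<ge> 5\<close>.\<close>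
  define C where "C = Max {1, 16 * \<kappa> / \<delta>, 2048 * a / \<delta>\<^sup>2, (1 + 4 * \<nu>) / \<nu>, 4 / c}"
  have "filterlim (\<lambda>n::nat. ln (real n)) at_top sequentially"
    by (rule filterlim_compose[OF ln_at_top filterlim_real_sequentially])
  then have "eventually (\<lambda>n::nat. C \<le> ln (real n)) sequentially"
    by (simp add: filterlim_at_top)
  \<comment> \<open>Ensures that the edge probability is at most 1.\<close>
  moreover have "eventually (\<lambda>n::nat. ln (real n) / real n < 1 / a) sequentially"
    using lim_ln_over_n assms(1) by (intro order_tendstoD(2)[where y = 0]) auto
  ultimately have "eventually (\<lambda>n::nat. C \<le> ln (real n) \<and> ln (real n) / real n < 1 / a) sequentially"
    by (rule eventually_conj)
  then obtain N where N: "\<And>n. n \<ge> N \<Longrightarrow> C \<le> ln (real n) \<and> ln (real n) / real n < 1 / a"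
    by (auto simp: eventually_sequentially)
  have "measure_pmf.prob (cbm_pmf n (a * ln (real n) / real n) \<epsilon> \<sigma>)
             {W. sdp_unique_opt n (cbm_adj W) (\<lambda>i j. \<sigma> i * \<sigma> j)} \<ge> 1 - real n powr (- c)"
    if n: "n \<ge> N" and \<sigma>: "\<forall>i<n. \<sigma> i \<in> {-1, 1}" for n and \<sigma> :: "nat \<Rightarrow> real"
  proof -
    define L where "L = ln (real n)"
    define p where "p = a * L / n"
    have "C \<le> L" using N[OF n] by (simp add: L_def)
    then have Ls: "1 \<le> L" "16 * \<kappa> / \<delta> \<le> L" "2048 * a / \<delta>\<^sup>2 \<le> L" "(1 + 4 * \<nu>) / \<nu> \<le> L" "4 / c \<le> L"
      by (auto simp: C_def)
    have n1: "n > 1"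
    proof (rule ccontr)
      assume "\<not> n > 1"
      then have "n = 0 \<or> n = 1" by auto
      then show False using Ls(1) by (auto simp: L_def)
    qed
    have expL: "exp L = n" using n1 by (simp add: L_def)
    have L_le: "L \<le> n" using exp_ge_add_one_self[of L] expL by linarith
    have p_bounds: "0 \<le> p" "p \<le> 1" "p * n = a * L"
      using N[OF n] n1 assms(1) Ls(1) by (auto simp: p_def L_def field_simps)
    interpret cbm n p \<epsilon> \<sigma>
      using p_bounds assms \<sigma> by unfold_locales auto
    have "Pr {W. sdp_unique_opt n (cbm_adj W) (\<lambda>i j. \<sigma> i * \<sigma> j)} \<ge> 1 -
      (n * exp (x * (D * ln n) - p * (real n - 1) * (1 - (1 - \<epsilon>) * exp (- x) - \<epsilon> * exp x)) +
       n * exp (2 * p * n - K * ln n) + 2 / n + exp (- real n))"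
    proof (rule prob_sdp_unique_opt_ge[where \<delta> = \<delta> and \<eta> = \<eta> and \<beta> = \<beta> and \<kappa> = \<kappa> and \<theta> = \<theta> and a = a])
      show "\<delta> + 8 * \<eta> * K + 4 * \<beta> / \<eta> + 16 * a / \<kappa> \<le> D"
      proof -
        have "8 * \<eta> * K = D / 4" using K by (simp add: \<eta>_def)
        moreover have "4 * \<beta> / \<eta> = D / 4" using \<eta> by (simp add: \<beta>_def)
        moreover have "16 * a / \<kappa> \<le> D / 4" using \<kappa>(1) \<kappa>0 D by (simp add: field_simps)
        ultimately show ?thesis by (simp add: \<delta>_def)
      qed
      show "p * n = a * ln n" using p_bounds(3) by (simp only: L_def)
      show "\<theta> * \<beta> = 6" using \<beta> by (simp add: \<theta>_def)
      show "2 * a * exp \<theta> \<le> \<eta> * \<kappa>" using \<kappa>(2) \<eta> by (simp add: field_simps)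
      show "16 * \<kappa> \<le> \<delta> * ln n" using Ls(2) D by (simp add: \<delta>_def L_def field_simps)
      show "2048 * a \<le> \<delta>\<^sup>2 * ln n" using Ls(3) D by (simp add: \<delta>_def L_def field_simps)
    qed (use n1 assms x K D \<eta> \<beta> \<kappa>0 in \<open>auto simp: L_def \<delta>_def \<theta>_def\<close>)
    moreover have "n * exp (x * (D * ln n) - p * (real n - 1) * (1 - (1 - \<epsilon>) * exp (- x) - \<epsilon> * exp x)) +
       n * exp (2 * p * n - K * ln n) + 2 / n + exp (- real n) \<le> real n powr (- c)"
    proof -
      have eL: "exp (- L) \<le> exp (- 2 * c * L)"
        using c Ls(1) by simp
      have "p * (real n - 1) * \<phi> = (a * \<phi>) * L - (a * \<phi>) * L / n"
        using n1 by (simp add: p_def field_simps)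
      moreover have "(a * \<phi>) * L / n \<le> \<nu> * L"
      proof -
        have "1 + 4 * \<nu> \<le> \<nu> * L" using Ls(4) \<nu> by (simp add: field_simps)
        also have "\<dots> \<le> \<nu> * n" using L_le \<nu> by (intro mult_left_mono) auto
        finally have "(1 + 4 * \<nu>) * L \<le> (\<nu> * n) * L" using Ls(1) by (intro mult_right_mono) auto
        then show ?thesis unfolding \<nu>(2) using n1 by (simp add: field_simps)
      qed
      ultimately have "x * (D * L) - p * (real n - 1) * \<phi> \<le> - L - 2 * \<nu> * L"
        unfolding \<nu>(2) using x by (simp add: D_def algebra_simps)
      also have "\<dots> \<le> - L - 2 * c * L" using c Ls(1) by simp
      finally have "exp L * exp (x * (D * L) - p * (real n - 1) * \<phi>) \<le> exp L * exp (- L - 2 * c * L)"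
        by simp
      also have "\<dots> = exp (- 2 * c * L)" by (simp flip: exp_add)
      finally have T1: "n * exp (x * (D * L) - p * (real n - 1) * \<phi>) \<le> exp (- 2 * c * L)"
        unfolding expL .
      have "2 * p * n - K * L = - 2 * L" using p_bounds(3) by (simp add: K_def algebra_simps)
      then have "n * exp (2 * p * n - K * L) = exp L * exp (- 2 * L)" by (simp add: expL)
      also have "\<dots> = exp (- L)" by (simp flip: exp_add)
      finally have T2: "n * exp (2 * p * n - K * L) = exp (- L)" .
      have T3: "2 / n = 2 * exp (- L)" by (simp add: exp_minus expL divide_inverse)
      have T4: "exp (- real n) \<le> exp (- L)" using L_le by simp
      \<comment> \<open>The error terms amount to at most 1 + 1 + 2 + 1 = 5 multiples of
        \<open>exp (- 2 * c * L)\<close>.\<close>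
      have "4 \<le> c * L" using Ls(5) c by (simp add: field_simps)
      then have "5 \<le> exp (c * L)" using exp_ge_add_one_self[of "c * L"] by linarith
      then have "5 * exp (- 2 * c * L) \<le> exp (c * L) * exp (- 2 * c * L)"
        by (intro mult_right_mono) auto
      also have "\<dots> = exp (- c * L)" by (simp flip: exp_add)
      also have "\<dots> = real n powr (- c)" using n1 by (simp add: powr_def L_def)
      finally show ?thesis using T1 T2 T3 T4 eL unfolding L_def \<phi>_def by linarith
    qed
    ultimately show ?thesis unfolding p_def L_def by linarith
  qed
  then show ?thesis using c(1) by blast
qed

end
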